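(* Let $H$ be a complex separable Hilbert space and let $L\colon \operatorname{Dom}(L)\subset H\to H$ be a (densely defined) self-adjoint linear operator such that (a) $0\in\sigma(L)$; (b) $(-\delta,0)\subset\rho(L)$ for some $\delta>0$; (c) $\inf\sigma(L)=-\gamma$ for some (finite) $\gamma\geqslant0$. Let $N\colon H\to H$ be bounded, demicontinuous, $N(0)=0$, and suppose that there exists $\alpha>\gamma/\delta^2$ such that for all $u,u'\in H$ $$\langle N(u)-N(u'),u-u'\rangle_r\geqslant\alpha\|N_1(u)-N_1(u')\|^2 ,$$ where $N_1(u)=P_1N(u)$. Then for each $\varepsilon>0$ and each $h\in H$ the equation $$\varepsilon P_2u+Lu+N(u)=h$$ has precisely one solution $u\in\operatorname{Dom}(L)$. Here $P_1,P_2$ are the orthogonal projections onto the subspaces $H_1,H_2$ defined in the context.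
   Context: Notation: $\langle u,v\rangle_r=\operatorname{Re}\langle u,v\rangle$. $N$ is bounded if it maps bounded sets to bounded sets, and demicontinuous if norm convergence $u_k\to u_0$ implies weak convergence of $N(u_k)$ to $N(u_0)$. Let $\{E_\mu\}_{\mu\in\mathbb{R}}$ be the (right-continuous) spectral family of $L$ and $E_{0-}$ the strong limit of $E_{-1/k}$ as $k\to\infty$; put $H_1=\operatorname{Ran}(E_{-\delta})$, $H_2=\operatorname{Ker}E_{0-}$. Then $H=H_1\oplus H_2$ orthogonally, and $P_i$ is the orthogonal projection of $H$ onto $H_i$. *)

theory Defs
  imports "HOL-Analysis.Analysis"
begin

section \<open>Complex Hilbert spaces\<close>

text \<open>
  A complex inner product space extends the library's real one: \<open>cinner\<close> is linear in its first
  argument, and \<open>inner\<close> is its real part, so that norm and topology are those of \<open>cinner\<close>.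
\<close>

class complex_inner = real_inner +
  fixes scaleC :: "complex \<Rightarrow> 'a \<Rightarrow> 'a"  (infixr \<open>*\<^sub>C\<close> 75)
    and cinner :: "'a \<Rightarrow> 'a \<Rightarrow> complex"
  assumes scaleR_scaleC: "scaleR r x = scaleC (complex_of_real r) x"
    and scaleC_add_right: "scaleC a (x + y) = scaleC a x + scaleC a y"
    and scaleC_add_left: "scaleC (a + b) x = scaleC a x + scaleC b x"
    and scaleC_scaleC: "scaleC a (scaleC b x) = scaleC (a * b) x"
    and cinner_commute: "cinner x y = cnj (cinner y x)"
    and cinner_add_left: "cinner (x + y) z = cinner x z + cinner y z"
    and cinner_scaleC_left: "cinner (scaleC a x) y = a * cinner x y"
    and inner_eq_Re_cinner: "inner x y = Re (cinner x y)"

class complex_hilbert_space = complex_inner + complete_space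

instance complex_hilbert_space \<subseteq> banach ..

instantiation complex :: complex_hilbert_space
begin

definition scaleC_complex :: "complex \<Rightarrow> complex \<Rightarrow> complex"
  where "scaleC_complex a x = a * x"

definition cinner_complex :: "complex \<Rightarrow> complex \<Rightarrow> complex"
  where "cinner_complex x y = x * cnj y"

instance
  by standard
    (simp_all add: scaleC_complex_def cinner_complex_def scaleR_conv_of_real inner_complex_def
      algebra_simps)

end

lemma scaleC_one [simp]: "1 *\<^sub>C x = (x :: 'a::complex_inner)"
  using scaleR_scaleC[of 1 x] by simp

global_interpretation complex_vector:
  vector_space "scaleC :: complex \<Rightarrow> 'a \<Rightarrow> 'a::complex_inner"
  by standard (simp_all add: scaleC_add_right scaleC_add_left scaleC_scaleC)

section \<open>Unbounded operators\<close>

text \<open>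
  An operator is a pair of its domain \<open>D\<close> and a function \<open>L\<close> whose values outside \<open>D\<close> play no role.
\<close>

definition linear_operator :: "'a::complex_inner set \<Rightarrow> ('a \<Rightarrow> 'a) \<Rightarrow> bool"
  where "linear_operator D L \<longleftrightarrow> complex_vector.subspace D \<and>
    (\<forall>u\<in>D. \<forall>v\<in>D. L (u + v) = L u + L v) \<and> (\<forall>c. \<forall>u\<in>D. L (c *\<^sub>C u) = c *\<^sub>C L u)"

definition adjoint_dom :: "'a::complex_inner set \<Rightarrow> ('a \<Rightarrow> 'a) \<Rightarrow> 'a set"
  where "adjoint_dom D L = {v. \<exists>w. \<forall>u\<in>D. cinner (L u) v = cinner u w}"

text \<open>The defining property below determines \<open>w\<close> when \<open>D\<close> is dense.\<close>

definition adjoint_op :: "'a::complex_inner set \<Rightarrow> ('a \<Rightarrow> 'a) \<Rightarrow> 'a \<Rightarrow> 'a"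
  where "adjoint_op D L v = (THE w. \<forall>u\<in>D. cinner (L u) v = cinner u w)"

definition selfadjoint :: "'a::complex_inner set \<Rightarrow> ('a \<Rightarrow> 'a) \<Rightarrow> bool"
  where "selfadjoint D L \<longleftrightarrow> linear_operator D L \<and> closure D = UNIV \<and>
    adjoint_dom D L = D \<and> (\<forall>v\<in>D. adjoint_op D L v = L v)"

definition resolvent_set :: "'a::complex_inner set \<Rightarrow> ('a \<Rightarrow> 'a) \<Rightarrow> complex set"
  where "resolvent_set D L = {z. bij_betw (\<lambda>u. L u - z *\<^sub>C u) D UNIV \<and>
    (\<exists>C. \<forall>u\<in>D. norm u \<le> C * norm (L u - z *\<^sub>C u))}"

definition spectrum :: "'a::complex_inner set \<Rightarrow> ('a \<Rightarrow> 'a) \<Rightarrow> complex set"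
  where "spectrum D L = - resolvent_set D L"

section \<open>Projections and the spectral family\<close>

definition orthogonal_projection :: "('a::complex_inner \<Rightarrow> 'a) \<Rightarrow> bool"
  where "orthogonal_projection P \<longleftrightarrow> Vector_Spaces.linear scaleC scaleC P \<and>
    (\<forall>x. P (P x) = P x) \<and> (\<forall>x y. cinner (P x) y = cinner x (P y))"

definition proj_onto :: "'a::complex_inner set \<Rightarrow> 'a \<Rightarrow> 'a"
  where "proj_onto S u = (THE p. p \<in> S \<and> (\<forall>v\<in>S. cinner (u - p) v = 0))"

definition resolution_of_identity :: "(real \<Rightarrow> 'a::complex_inner \<Rightarrow> 'a) \<Rightarrow> bool"
  where "resolution_of_identity E \<longleftrightarrow>
    (\<forall>\<mu>. orthogonal_projection (E \<mu>)) \<and>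
    (\<forall>\<mu> \<nu> u. \<mu> \<le> \<nu> \<longrightarrow> E \<mu> (E \<nu> u) = E \<mu> u \<and> E \<nu> (E \<mu> u) = E \<mu> u) \<and>
    (\<forall>\<mu> u. ((\<lambda>\<nu>. E \<nu> u) \<longlongrightarrow> E \<mu> u) (at_right \<mu>)) \<and>
    (\<forall>u. ((\<lambda>\<mu>. E \<mu> u) \<longlongrightarrow> 0) at_bot) \<and>
    (\<forall>u. ((\<lambda>\<mu>. E \<mu> u) \<longlongrightarrow> u) at_top)"

text \<open>
  The Stieltjes measure of \<open>\<mu> \<mapsto> \<langle>E \<mu> u, u\<rangle>\<close>, a function which is real, nondecreasing and
  right-continuous if \<open>E\<close> is a resolution of the identity.
\<close>

definition spectral_measure :: "(real \<Rightarrow> 'a::complex_inner \<Rightarrow> 'a) \<Rightarrow> 'a \<Rightarrow> real measure"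
  where "spectral_measure E u = interval_measure (\<lambda>\<mu>. Re (cinner (E \<mu> u) u))"

text \<open>
  The spectral representation of the operator as the integral of \<open>\<mu>\<close> with respect to \<open>E\<close>: the domain
  consists of the \<open>u\<close> with \<open>\<integral> \<mu>\<^sup>2 d\<langle>E \<mu> u, u\<rangle> < \<infinity>\<close>, and there \<open>\<langle>L u, u\<rangle> = \<integral> \<mu> d\<langle>E \<mu> u, u\<rangle>\<close>. The
  quadratic form determines \<open>L\<close> on its dense domain by polarization.
\<close>

definition spectral_family :: "'a::complex_inner set \<Rightarrow> ('a \<Rightarrow> 'a) \<Rightarrow> (real \<Rightarrow> 'a \<Rightarrow> 'a) \<Rightarrow> bool"
  where "spectral_family D L E \<longleftrightarrow> resolution_of_identity E \<and>
    D = {u. integrable (spectral_measure E u) (\<lambda>\<mu>. \<mu>\<^sup>2)} \<and>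
    (\<forall>u\<in>D. cinner (L u) u = complex_of_real (integral\<^sup>L (spectral_measure E u) (\<lambda>\<mu>. \<mu>)))"

definition left_limit_0 :: "(real \<Rightarrow> 'a::complex_inner \<Rightarrow> 'a) \<Rightarrow> 'a \<Rightarrow> 'a"
  where "left_limit_0 E u = lim (\<lambda>k. E (- 1 / real (Suc k)) u)"

definition H1 :: "(real \<Rightarrow> 'a::complex_inner \<Rightarrow> 'a) \<Rightarrow> real \<Rightarrow> 'a set"
  where "H1 E \<delta> = range (E (- \<delta>))"

definition H2 :: "(real \<Rightarrow> 'a::complex_inner \<Rightarrow> 'a) \<Rightarrow> 'a set"
  where "H2 E = {u. left_limit_0 E u = 0}"

section \<open>Nonlinear maps\<close>

definition bounded_map :: "('a::complex_inner \<Rightarrow> 'a) \<Rightarrow> bool"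
  where "bounded_map N \<longleftrightarrow> (\<forall>B. bounded B \<longrightarrow> bounded (N ` B))"

definition demicontinuous :: "('a::complex_inner \<Rightarrow> 'a) \<Rightarrow> bool"
  where "demicontinuous N \<longleftrightarrow> (\<forall>u u0. u \<longlonglongrightarrow> u0 \<longrightarrow>
    (\<forall>v. (\<lambda>k. cinner (N (u k)) v) \<longlonglongrightarrow> cinner (N u0) v))"

end

theory Submission
  imports Defs "HOL-Probability.Distribution_Functions"
begin

text \<open>
  Put \<open>P = E (-\<delta>)\<close> and \<open>Q = I - P\<close>. A spectral family is constant on any open interval of the resolvent set,
  so \<open>E\<close> does not move on \<open>[-\<delta>, 0)\<close> and vanishes below \<open>-\<gamma>\<close>. Hence \<open>P\<close> and \<open>Q\<close> are the projections onto
  \<open>H\<^sub>1\<close> and \<open>H\<^sub>2\<close>, they reduce \<open>L\<close>, the range of \<open>P\<close> lies in the domain, and \<open>\<langle>L u, u\<rangle> \<le> -\<delta> \<parallel>u\<parallel>\<^sup>2\<close> on \<open>H\<^sub>1\<close>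
  while \<open>\<langle>L u, u\<rangle> \<ge> 0\<close> on \<open>H\<^sub>2\<close>. On \<open>H\<^sub>1\<close> this gives \<open>\<delta> \<parallel>u\<parallel> \<le> \<parallel>L u\<parallel>\<close> and therefore
  \<open>\<langle>L u, u\<rangle> \<ge> -\<parallel>L u\<parallel>\<^sup>2 / \<delta>\<close>. Since \<open>\<gamma> \<ge> \<delta>\<close> unless \<open>H\<^sub>1 = 0\<close>, the hypothesis on \<open>\<alpha>\<close> says that the term
  \<open>\<alpha> \<parallel>P (N u) - P (N u')\<parallel>\<^sup>2\<close> outweighs this negative part of \<open>L\<close>.

  Uniqueness: for the difference \<open>w\<close> of two solutions, \<open>P (N u) - P (N u') = -L (P w)\<close>; pairing the
  difference of the equations with \<open>w\<close> gives
  \<open>(\<alpha> - 1/\<delta>) \<parallel>L (P w)\<parallel>\<^sup>2 + \<epsilon> \<parallel>Q w\<parallel>\<^sup>2 \<le> 0\<close> (\<open>solution_unique\<close>).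

  Existence: absorb \<open>h\<close> into \<open>N\<close>. Exchanging the \<open>H\<^sub>1\<close> components of argument and value preserves
  the pairing \<open>\<langle>y, u\<rangle>\<close>, so it turns the graph of \<open>N\<close> into a monotone relation, which stays monotone after
  \<open>\<alpha> P\<close> is subtracted; this relation is maximal (\<open>swap_maximal_monotone\<close>). The same exchange
  inverts \<open>L\<close> on \<open>H\<^sub>1\<close>, where the inverse is at least \<open>-1/\<delta>\<close>; adding \<open>\<alpha> P\<close> back makes the linear part a coercive
  operator \<open>S\<close> (\<open>S_coercive\<close>). So the problem is to find
  a zero of the sum of a maximal monotone relation and a coercive selfadjoint operator. The relation is replaced by its
  Yosida approximations, for which the equation is a contraction (\<open>regularized_solution\<close>). Boundedness of
  \<open>N\<close> bounds their values along the approximate solutions (\<open>regularized_bound\<close>); as usual for Yosida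
  approximations the approximate solutions are then a Cauchy sequence, and since \<open>N\<close> is
  demicontinuous and \<open>L\<close> is selfadjoint, the limit solves the equation (\<open>solution_exists\<close>).

  The Yosida approximations exist by Minty's theorem (\<open>maximal_monotone_surj\<close>), which is derived by
  minimizing the Fitzpatrick function of the relation plus half the squared norm. That function is
  strongly convex, so its minimizing sequences converge in norm.
\<close>

section \<open>Maximal monotone relations\<close>

lemma Cauchy_of_square_bound:
  fixes x :: "nat \<Rightarrow> 'a::real_normed_vector"
  assumes bound: "\<And>j k. (norm (x j - x k))\<^sup>2 \<le> c * (1 / real (Suc j) + 1 / real (Suc k))"
  shows "Cauchy x"
proof (rule metric_CauchyI)
  fix e :: real assume e: "e > 0"
  obtain M where M: "2 * \<bar>c\<bar> / e\<^sup>2 < real M" using reals_Archimedean2 by blast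
  have "0 \<le> 2 * \<bar>c\<bar> / e\<^sup>2" by simp
  then have "M > 0" using M by linarith
  show "\<exists>M. \<forall>j\<ge>M. \<forall>k\<ge>M. dist (x j) (x k) < e"
  proof (intro exI allI impI)
    fix j k assume jk: "M \<le> j" "M \<le> k"
    have "1 / real (Suc j) \<le> 1 / real M" "1 / real (Suc k) \<le> 1 / real M"
      using jk \<open>M > 0\<close> by (auto simp: field_simps)
    then have "\<bar>c\<bar> * (1 / real (Suc j) + 1 / real (Suc k)) \<le> \<bar>c\<bar> * (1 / real M + 1 / real M)"
      by (intro mult_left_mono add_mono) auto
    moreover have "c * (1 / real (Suc j) + 1 / real (Suc k)) \<le> \<bar>c\<bar> * (1 / real (Suc j) + 1 / real (Suc k))"
      by (intro mult_right_mono) auto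
    moreover have "\<bar>c\<bar> * (1 / real M + 1 / real M) = 2 * \<bar>c\<bar> / real M" by simp
    ultimately have "(norm (x j - x k))\<^sup>2 \<le> 2 * \<bar>c\<bar> / real M"
      using bound[of j k] by linarith
    also have "\<dots> < e\<^sup>2" using M e \<open>M > 0\<close> by (simp add: field_simps)
    finally show "dist (x j) (x k) < e"
      using e by (simp add: dist_norm power_less_imp_less_base)
  qed
qed

text \<open>
  The set \<open>C\<close> stands for the epigraph of a closed convex function \<open>f\<close>; the point obtained is the
  minimizer of \<open>f p + \<parallel>p\<parallel>\<^sup>2 / 2\<close>, and the conclusion is the first-order condition
  \<open>- p0 \<in> \<partial>f p0\<close>. Strong convexity makes every minimizing sequence Cauchy.
\<close>

lemma proximal_point:
  fixes C :: "('b::{real_inner,complete_space} \<times> real) set"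
  assumes cl: "closed C" and cv: "convex C" and ne: "C \<noteq> {}"
    and bd: "\<And>p r. (p, r) \<in> C \<Longrightarrow> m \<le> r + (norm p)\<^sup>2 / 2"
  obtains p0 r0 where "(p0, r0) \<in> C" "\<And>p r. (p, r) \<in> C \<Longrightarrow> r0 \<le> r + p0 \<bullet> (p - p0)"
proof -
  define g where "g q = snd q + (norm (fst q))\<^sup>2 / 2" for q :: "'b \<times> real"
  define i where "i = Inf (g ` C)"
  have bg: "bdd_below (g ` C)"
    using bd by (auto simp: bdd_below_def g_def intro!: exI[of _ m])
  have low: "i \<le> g q" if "q \<in> C" for q
    unfolding i_def using bg that by (auto intro: cInf_lower)
  have "\<exists>q\<in>C. g q < i + 1 / real (Suc n)" for n
    using cInf_lessD[of "g ` C" "i + 1 / real (Suc n)"] ne by (auto simp: i_def)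
  then obtain q where qC: "\<And>n. q n \<in> C" and qi: "\<And>n. g (q n) < i + 1 / real (Suc n)"
    by metis
  \<comment> \<open>The midpoint of two almost minimal points is no better than the infimum: parallelogram identity.\<close>
  have mid: "(norm (fst (q j) - fst (q k)))\<^sup>2 \<le> 4 * (1 / real (Suc j) + 1 / real (Suc k))" for j k
  proof -
    have "(1/2) *\<^sub>R q j + (1/2) *\<^sub>R q k \<in> C"
      using cv qC by (intro convexD) auto
    then have "i \<le> g ((1/2) *\<^sub>R q j + (1/2) *\<^sub>R q k)" by (rule low)
    also have "\<dots> = g (q j) / 2 + g (q k) / 2 - (norm (fst (q j) - fst (q k)))\<^sup>2 / 8"
      by (simp add: g_def power2_norm_eq_inner inner_add inner_diff inner_commute field_simps)
    finally show ?thesis using qi[of j] qi[of k] by simp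
  qed
  have "Cauchy (\<lambda>n. fst (q n))"
    using mid by (rule Cauchy_of_square_bound)
  then obtain p0 where p0: "(\<lambda>n. fst (q n)) \<longlonglongrightarrow> p0"
    using Cauchy_convergent convergent_def by blast
  have "(\<lambda>n. g (q n)) \<longlonglongrightarrow> i"
  proof (rule tendsto_sandwich[of "\<lambda>_. i" _ _ "\<lambda>n. i + 1 / real (Suc n)"])
    show "(\<lambda>n. i + 1 / real (Suc n)) \<longlonglongrightarrow> i"
      using LIMSEQ_inverse_real_of_nat_add[of i] by (simp add: inverse_eq_divide)
  qed (use low qC qi in \<open>auto intro!: always_eventually less_imp_le\<close>)
  then have "(\<lambda>n. g (q n) - (norm (fst (q n)))\<^sup>2 / 2) \<longlonglongrightarrow> i - (norm p0)\<^sup>2 / 2"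
    by (intro tendsto_intros p0) auto
  then have r0: "(\<lambda>n. snd (q n)) \<longlonglongrightarrow> i - (norm p0)\<^sup>2 / 2"
    by (simp add: g_def)
  define r0' where "r0' = i - (norm p0)\<^sup>2 / 2"
  have "q \<longlonglongrightarrow> (p0, r0')"
    using tendsto_Pair[OF p0 r0] by (simp add: r0'_def)
  then have mem: "(p0, r0') \<in> C"
    using cl qC closed_sequentially by blast
  have "r0' \<le> r + p0 \<bullet> (p - p0)" if pr: "(p, r) \<in> C" for p r
  proof -
    \<comment> \<open>Compare with the point at parameter \<open>t\<close> on the segment to \<open>(p, r)\<close>, divide by \<open>t\<close> and let \<open>t\<close> tend to \<open>0\<close>.\<close>
    have *: "0 \<le> (r - r0' + p0 \<bullet> (p - p0)) + t * ((norm (p - p0))\<^sup>2 / 2)" if t: "0 < t" "t < 1" for t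
    proof -
      have nn: "(norm (p0 + t *\<^sub>R (p - p0)))\<^sup>2
          = (norm p0)\<^sup>2 + 2 * t * (p0 \<bullet> (p - p0)) + t\<^sup>2 * (norm (p - p0))\<^sup>2"
        unfolding power2_norm_eq_inner inner_add by (simp add: inner_commute power2_eq_square)
      have "(1 - t) *\<^sub>R (p0, r0') + t *\<^sub>R (p, r) \<in> C"
        using cv mem pr t by (intro convexD) auto
      then have "i \<le> g ((1 - t) *\<^sub>R (p0, r0') + t *\<^sub>R (p, r))" by (rule low)
      also have "\<dots> = r0' + t * (r - r0') + (norm (p0 + t *\<^sub>R (p - p0)))\<^sup>2 / 2"
        by (simp add: g_def algebra_simps)
      also have "\<dots> = i + t * ((r - r0' + p0 \<bullet> (p - p0)) + t * ((norm (p - p0))\<^sup>2 / 2))"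
        unfolding nn by (simp add: r0'_def power2_eq_square field_simps)
      finally show ?thesis using t by (simp add: zero_le_mult_iff)
    qed
    have "((\<lambda>t. (r - r0' + p0 \<bullet> (p - p0)) + t * ((norm (p - p0))\<^sup>2 / 2)) \<longlongrightarrow>
        (r - r0' + p0 \<bullet> (p - p0)) + 0 * ((norm (p - p0))\<^sup>2 / 2)) (at_right 0)"
      by (intro tendsto_intros)
    moreover have "\<forall>\<^sub>F t in at_right 0. 0 \<le> (r - r0' + p0 \<bullet> (p - p0)) + t * ((norm (p - p0))\<^sup>2 / 2)"
      using * by (intro eventually_at_rightI[of 0 1]) auto
    ultimately have "0 \<le> (r - r0' + p0 \<bullet> (p - p0)) + 0 * ((norm (p - p0))\<^sup>2 / 2)"
      by (rule tendsto_lowerbound) simp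
    then show ?thesis by simp
  qed
  with mem show ?thesis using that by blast
qed

definition monotone_rel :: "('a::real_inner \<times> 'a) set \<Rightarrow> bool"
  where "monotone_rel G \<longleftrightarrow> (\<forall>(a, b)\<in>G. \<forall>(c, d)\<in>G. 0 \<le> (b - d) \<bullet> (a - c))"

definition maximal_monotone :: "('a::real_inner \<times> 'a) set \<Rightarrow> bool"
  where "maximal_monotone G \<longleftrightarrow> monotone_rel G \<and>
    (\<forall>x y. (\<forall>(a, b)\<in>G. 0 \<le> (y - b) \<bullet> (x - a)) \<longrightarrow> (x, y) \<in> G)"

text \<open>
  The set \<open>C\<close> in the proof is the epigraph of the Fitzpatrick function
  \<open>\<phi> (x, y) = sup {\<langle>x, b\<rangle> + \<langle>y, a\<rangle> - \<langle>a, b\<rangle> | (a, b) \<in> G}\<close>. Monotonicity gives \<open>\<phi> (a, b) \<le> \<langle>a, b\<rangle>\<close> on \<open>G\<close>, maximality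
  gives \<open>\<phi> (x, y) \<ge> \<langle>x, y\<rangle>\<close> everywhere. If \<open>(x, y)\<close> minimizes \<open>\<phi> + \<parallel>\<cdot>\<parallel>\<^sup>2 / 2\<close>, the first-order condition at the
  points of \<open>G\<close> says that \<open>(-y, -x)\<close> is monotonically related to \<open>G\<close>, so it belongs to \<open>G\<close>; the condition at
  that very point then forces \<open>x + y = 0\<close>.
\<close>

lemma maximal_monotone_has_opposite_pair:
  fixes G :: "('a::{real_inner,complete_space} \<times> 'a) set"
  assumes G: "maximal_monotone G"
  shows "\<exists>x. (x, - x) \<in> G"
proof -
  have mono: "0 \<le> (b - d) \<bullet> (a - c)" if "(a, b) \<in> G" "(c, d) \<in> G" for a b c d
    using G that unfolding maximal_monotone_def monotone_rel_def by blast
  have max: "(x, y) \<in> G" if "\<And>a b. (a, b) \<in> G \<Longrightarrow> 0 \<le> (y - b) \<bullet> (x - a)" for x y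
    using G that unfolding maximal_monotone_def by blast
  define C where "C = {q :: ('a \<times> 'a) \<times> real.
      \<forall>(a, b)\<in>G. fst (fst q) \<bullet> b + snd (fst q) \<bullet> a - a \<bullet> b \<le> snd q}"
  have C_alt: "C = (\<Inter>(a, b)\<in>G. {q. fst q \<bullet> (b, a) - a \<bullet> b \<le> snd q})"
    unfolding C_def by (auto simp: inner_prod_def)
  have "closed C"
    unfolding C_alt by (intro closed_INT ballI) (auto intro!: closed_Collect_le continuous_intros)
  moreover have "convex C"
    unfolding C_alt
  proof (intro convex_INT ballI, clarify)
    fix a b :: 'a
    have "{q :: ('a \<times> 'a) \<times> real. fst q \<bullet> (b, a) - a \<bullet> b \<le> snd q} = {q. ((b, a), - 1) \<bullet> q \<le> a \<bullet> b}"
      by (auto simp: inner_prod_def inner_commute)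
    then show "convex {q :: ('a \<times> 'a) \<times> real. fst q \<bullet> (b, a) - a \<bullet> b \<le> snd q}"
      by (simp add: convex_halfspace_le)
  qed
  moreover have "C \<noteq> {}"
  proof -
    obtain a b where ab: "(a, b) \<in> G" using max by blast
    have "a \<bullet> d + b \<bullet> c - c \<bullet> d \<le> a \<bullet> b" if "(c, d) \<in> G" for c d
      using mono[OF ab that] by (simp add: inner_diff inner_commute algebra_simps)
    then have "((a, b), a \<bullet> b) \<in> C" by (auto simp: C_def)
    then show ?thesis by blast
  qed
  moreover have low: "x \<bullet> y \<le> r" if "((x, y), r) \<in> C" for x y r
  proof (cases "(x, y) \<in> G")
    case True
    then show ?thesis using that by (auto simp: C_def inner_commute)
  next
    case False
    then obtain a b where ab: "(a, b) \<in> G" "(y - b) \<bullet> (x - a) < 0"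
      using max[where x = x and y = y] by (meson not_le)
    then show ?thesis using that
      by (auto simp: C_def inner_diff inner_commute algebra_simps dest!: bspec[OF _ ab(1)])
  qed
  moreover have "0 \<le> r + (norm p)\<^sup>2 / 2" if pr: "(p, r) \<in> C" for p r
  proof -
    have "fst p \<bullet> snd p \<le> r" using low[of "fst p" "snd p" r] pr by simp
    moreover have "0 \<le> (fst p + snd p) \<bullet> (fst p + snd p)" by simp
    ultimately show ?thesis
      by (simp add: power2_norm_eq_inner inner_prod_def inner_add inner_commute field_simps
          del: inner_ge_zero)
  qed
  ultimately obtain p0 r0 where p0: "(p0, r0) \<in> C"
    and opt: "\<And>p r. (p, r) \<in> C \<Longrightarrow> r0 \<le> r + p0 \<bullet> (p - p0)"
    using proximal_point[of C 0] by metis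
  obtain x y where xy: "p0 = (x, y)" by (cases p0)
  have r0: "x \<bullet> y \<le> r0" using low p0 xy by blast
  have key: "(x + y) \<bullet> (x + y) \<le> (- x - b) \<bullet> (- y - a)" if ab: "(a, b) \<in> G" for a b
  proof -
    have "((a, b), a \<bullet> b) \<in> C"
      using mono[OF ab] by (auto simp: C_def inner_diff inner_commute algebra_simps)
    from opt[OF this] have "r0 \<le> a \<bullet> b + x \<bullet> (a - x) + y \<bullet> (b - y)"
      by (simp add: xy inner_prod_def)
    with r0 show ?thesis by (simp add: inner_diff inner_add inner_commute algebra_simps)
  qed
  have mem: "(- y, - x) \<in> G"
    by (rule max) (use key inner_ge_zero[of "x + y"] in \<open>meson order_trans\<close>)
  from key[OF mem] have "x + y = 0"
    by (metis diff_self inner_eq_zero_iff inner_ge_zero inner_zero_left order_antisym)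
  then have "- x = - (- y)" by (simp add: add_eq_0_iff)
  then show ?thesis using mem by metis
qed

text \<open>
  Minty's theorem: \<open>k I + G\<close> is onto. The form \<open>k q\<close> of the right-hand side makes \<open>a\<close> the resolvent
  \<open>J q\<close> and \<open>b = k (q - J q)\<close> the Yosida approximation at \<open>q\<close>.
\<close>

lemma maximal_monotone_surj:
  fixes G :: "('a::{real_inner,complete_space} \<times> 'a) set"
  assumes G: "maximal_monotone G" and k: "k > 0"
  shows "\<exists>a b. (a, b) \<in> G \<and> k *\<^sub>R a + b = k *\<^sub>R q"
proof -
  define G' where "G' = {(x, y). (x + q, k *\<^sub>R y) \<in> G}"
  have "maximal_monotone G'"
    unfolding maximal_monotone_def
  proof (intro conjI allI impI)
    show "monotone_rel G'"
      unfolding monotone_rel_def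
    proof clarify
      fix a b c d assume "(a, b) \<in> G'" "(c, d) \<in> G'"
      then have "0 \<le> (k *\<^sub>R b - k *\<^sub>R d) \<bullet> ((a + q) - (c + q))"
        using G unfolding maximal_monotone_def monotone_rel_def G'_def by blast
      also have "\<dots> = k * ((b - d) \<bullet> (a - c))"
        by (simp add: inner_diff algebra_simps)
      finally show "0 \<le> (b - d) \<bullet> (a - c)" using k by (simp add: zero_le_mult_iff)
    qed
  next
    fix x y assume *: "\<forall>(a, b)\<in>G'. 0 \<le> (y - b) \<bullet> (x - a)"
    have "0 \<le> (k *\<^sub>R y - b) \<bullet> (x + q - a)" if "(a, b) \<in> G" for a b
    proof -
      have "(a - q, b /\<^sub>R k) \<in> G'" using that k by (simp add: G'_def)
      then have "0 \<le> (y - b /\<^sub>R k) \<bullet> (x - (a - q))" using * by blast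
      then have "0 \<le> k * ((y - b /\<^sub>R k) \<bullet> (x - (a - q)))" using k by simp
      also have "\<dots> = (k *\<^sub>R (y - b /\<^sub>R k)) \<bullet> (x + q - a)"
        by (simp add: algebra_simps)
      finally show ?thesis using k by (simp add: scaleR_diff_right)
    qed
    then have "(x + q, k *\<^sub>R y) \<in> G"
      using G unfolding maximal_monotone_def by blast
    then show "(x, y) \<in> G'" by (simp add: G'_def)
  qed
  then obtain x where "(x, - x) \<in> G'"
    using maximal_monotone_has_opposite_pair by blast
  then have "(x + q, - (k *\<^sub>R x)) \<in> G" by (simp add: G'_def)
  then show ?thesis
    by (intro exI[of _ "x + q"] exI[of _ "- (k *\<^sub>R x)"]) (simp add: algebra_simps)
qed

text \<open>
  Minty's argument: test the relation at \<open>u + t (y - M u)\<close> and let \<open>t\<close> tend to \<open>0\<close>.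
\<close>

lemma hemicontinuous_monotone_maximal:
  fixes M :: "'a::real_inner \<Rightarrow> 'a"
  assumes hemi: "\<And>u v. (\<lambda>n. M (u + (1 / real (Suc n)) *\<^sub>R v) \<bullet> v) \<longlonglongrightarrow> M u \<bullet> v"
    and rel: "\<And>a. 0 \<le> (y - M a) \<bullet> (u - a)"
  shows "y = M u"
proof -
  define v where "v = y - M u"
  have "(y - M (u + (1 / real (Suc n)) *\<^sub>R v)) \<bullet> v \<le> 0" for n
    using rel[of "u + (1 / real (Suc n)) *\<^sub>R v"] by (simp add: divide_le_0_iff)
  moreover have "(\<lambda>n. y \<bullet> v - M (u + (1 / real (Suc n)) *\<^sub>R v) \<bullet> v) \<longlonglongrightarrow> y \<bullet> v - M u \<bullet> v"
    by (intro tendsto_intros hemi)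
  ultimately have "y \<bullet> v - M u \<bullet> v \<le> 0"
    by (intro LIMSEQ_le_const2) (auto simp: inner_diff_left)
  then have "v \<bullet> v \<le> 0" by (simp add: v_def inner_diff_left)
  then have "v = 0" by (metis inner_eq_zero_iff inner_ge_zero order_antisym)
  then show ?thesis by (simp add: v_def)
qed

section \<open>Reduced selfadjoint operators\<close>

text \<open>
  Selfadjointness in terms of the real inner product. The assumption \<open>L_maximal\<close> says that \<open>L\<close> extends
  its adjoint; it serves both to recognize elements of the domain and to pass to weak limits.
\<close>

locale selfadjoint_real =
  fixes D :: "'a::{real_inner,complete_space} set" and L :: "'a \<Rightarrow> 'a"
  assumes D: "subspace D"
    and L_add: "\<lbrakk>u \<in> D; v \<in> D\<rbrakk> \<Longrightarrow> L (u + v) = L u + L v"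
    and L_scaleR: "u \<in> D \<Longrightarrow> L (r *\<^sub>R u) = r *\<^sub>R L u"
    and L_sym: "\<lbrakk>u \<in> D; v \<in> D\<rbrakk> \<Longrightarrow> L u \<bullet> v = u \<bullet> L v"
    and L_maximal: "(\<And>u. u \<in> D \<Longrightarrow> L u \<bullet> v = u \<bullet> w) \<Longrightarrow> v \<in> D \<and> L v = w"
begin

lemma L_diff: "\<lbrakk>u \<in> D; v \<in> D\<rbrakk> \<Longrightarrow> L (u - v) = L u - L v"
  using L_add[of u "- 1 *\<^sub>R v"] L_scaleR[of v "- 1"] subspace_neg[OF D, of v] by simp

end

text \<open>
  The projection \<open>P\<close> reduces \<open>L\<close> to a negative part with spectrum below \<open>-\<delta>\<close> and a
  nonnegative part.
\<close>

locale split_operator = selfadjoint_real D L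
  for D :: "'a::{real_inner,complete_space} set" and L :: "'a \<Rightarrow> 'a" +
  fixes P :: "'a \<Rightarrow> 'a" and \<delta> :: real
  assumes P_linear: "linear P"
    and P_idem: "P (P x) = P x"
    and P_sym: "P x \<bullet> y = x \<bullet> P y"
    and P_D: "P x \<in> D"
    and L_P: "u \<in> D \<Longrightarrow> L (P u) = P (L u)"
    and \<delta>_pos: "\<delta> > 0"
    and L_neg: "L (P u) \<bullet> P u \<le> - \<delta> * (norm (P u))\<^sup>2"
    and L_nonneg: "\<lbrakk>u \<in> D; P u = 0\<rbrakk> \<Longrightarrow> 0 \<le> L u \<bullet> u"
begin

definition Q :: "'a \<Rightarrow> 'a" where "Q x = x - P x"

lemma P_add: "P (x + y) = P x + P y" and P_diff: "P (x - y) = P x - P y"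
  and P_scaleR: "P (r *\<^sub>R x) = r *\<^sub>R P x" and P_minus: "P (- x) = - P x" and P_0: "P 0 = 0"
  using P_linear by (auto simp: linear_add linear_diff linear_scale linear_neg linear_0)

lemma Q_linear: "linear Q"
  by (rule linearI) (simp_all add: Q_def P_add P_scaleR algebra_simps)

lemma PQ: "P (Q x) = 0" and QP: "Q (P x) = 0" and QQ: "Q (Q x) = Q x"
  by (simp_all add: Q_def P_diff P_idem)

lemma P_Q_orth: "P x \<bullet> Q y = 0"
  by (simp add: P_sym PQ)

lemma Q_P_orth: "Q y \<bullet> P x = 0"
  by (metis P_Q_orth inner_commute)

lemma norm_split: "(norm x)\<^sup>2 = (norm (P x))\<^sup>2 + (norm (Q x))\<^sup>2"
proof -
  have "x = P x + Q x" by (simp add: Q_def)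
  then have "(norm x)\<^sup>2 = (P x + Q x) \<bullet> (P x + Q x)" by (metis power2_norm_eq_inner)
  then show ?thesis by (simp add: inner_add P_Q_orth Q_P_orth power2_norm_eq_inner)
qed

lemma norm_P_le: "norm (P x) \<le> norm x" and norm_Q_le: "norm (Q x) \<le> norm x"
  by (rule power2_le_imp_le; simp add: norm_split[of x])+

lemma bounded_linear_P: "bounded_linear P"
  by (rule bounded_linear_intro[of _ 1]) (auto simp: P_add P_scaleR norm_P_le)

lemma bounded_linear_Q: "bounded_linear Q"
  unfolding Q_def by (intro bounded_linear_sub bounded_linear_P bounded_linear_ident)

lemma Q_D: "u \<in> D \<Longrightarrow> Q u \<in> D"
  unfolding Q_def by (intro subspace_diff[OF D] P_D)

lemma P_L_P: "P (L (P u)) = L (P u)"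
  using L_P[OF P_D, of u] by (simp add: P_idem)

lemma P_L_Q: "u \<in> D \<Longrightarrow> P (L (Q u)) = 0"
  using L_P[OF Q_D, of u] L_scaleR[OF P_D, of 0 u] by (simp add: PQ P_0)

lemma L_split: "u \<in> D \<Longrightarrow> L u = L (P u) + L (Q u)"
  using L_add[OF P_D Q_D, of u u] by (simp add: Q_def)

lemma norm_L_P_ge: "\<delta> * norm (P u) \<le> norm (L (P u))"
proof (cases "P u = 0")
  case False
  have "\<delta> * (norm (P u))\<^sup>2 \<le> - (L (P u) \<bullet> P u)" using L_neg[of u] by simp
  also have "\<dots> \<le> norm (L (P u)) * norm (P u)"
    using norm_cauchy_schwarz[of "- L (P u)" "P u"] by simp
  finally show ?thesis using False by (simp add: power2_eq_square)
qed simp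

text \<open>
  This trades the lower bound of the form, in terms of \<open>\<parallel>P u\<parallel>\<close>, for one in terms of \<open>\<parallel>L (P u)\<parallel>\<close>. For
  a solution \<open>u\<close>, \<open>L (P u)\<close> is known up to data from the \<open>P\<close> component of the nonlinearity.
\<close>

lemma L_P_form_ge: "- (norm (L (P u)))\<^sup>2 / \<delta> \<le> L (P u) \<bullet> P u"
proof -
  have "- (L (P u) \<bullet> P u) \<le> norm (L (P u)) * norm (P u)"
    using norm_cauchy_schwarz[of "- L (P u)" "P u"] by simp
  also have "\<dots> \<le> norm (L (P u)) * (norm (L (P u)) / \<delta>)"
    using norm_L_P_ge[of u] \<delta>_pos by (intro mult_left_mono) (auto simp: field_simps)
  finally show ?thesis by (simp add: power2_eq_square field_simps)
qed

text \<open>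
  On the range of \<open>P\<close> the roles of argument and value are exchanged, so the new unknown there is \<open>-L (P x)\<close>
  and the operator is \<open>L\<^bsup>-1\<^esup>\<close>. To avoid this inverse, everything is parametrized by \<open>x\<close>: the unknown is \<open>Z x\<close>, and
  \<open>S \<alpha> \<epsilon> x\<close> is the value at \<open>Z x\<close> of the operator \<open>L\<^bsup>-1\<^esup> + \<alpha>\<close> on the range of \<open>P\<close> and \<open>L + \<epsilon>\<close> on the range of \<open>Q\<close>.
\<close>

definition Z :: "'a \<Rightarrow> 'a" where "Z x = Q x - L (P x)"

definition S :: "real \<Rightarrow> real \<Rightarrow> 'a \<Rightarrow> 'a"
  where "S \<alpha> \<epsilon> x = - \<alpha> *\<^sub>R L (P x) - P x + (L (Q x) + \<epsilon> *\<^sub>R Q x)"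

lemma Z_diff: "Z (x - y) = Z x - Z y"
  by (simp add: Z_def linear_diff[OF Q_linear] P_diff L_diff P_D algebra_simps)

lemma S_diff: "\<lbrakk>x \<in> D; y \<in> D\<rbrakk> \<Longrightarrow> S \<alpha> \<epsilon> (x - y) = S \<alpha> \<epsilon> x - S \<alpha> \<epsilon> y"
  by (simp add: S_def linear_diff[OF Q_linear] P_diff L_diff P_D Q_D algebra_simps)

lemma P_Z: "P (Z x) = - L (P x)" and Q_Z: "Q (Z x) = Q x"
  by (simp_all add: Z_def P_diff PQ P_L_P linear_diff[OF Q_linear] QQ)
     (simp add: Q_def P_L_P)

lemma P_S: "x \<in> D \<Longrightarrow> P (S \<alpha> \<epsilon> x) = - \<alpha> *\<^sub>R L (P x) - P x"
  by (simp add: S_def P_add P_diff P_scaleR P_minus P_L_P P_L_Q PQ P_idem)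

lemma Q_S: "x \<in> D \<Longrightarrow> Q (S \<alpha> \<epsilon> x) = L (Q x) + \<epsilon> *\<^sub>R Q x"
  using P_S[of x \<alpha> \<epsilon>] by (simp add: Q_def[of "S \<alpha> \<epsilon> x"]) (simp add: S_def)

lemma norm_Z: "(norm (Z x))\<^sup>2 = (norm (L (P x)))\<^sup>2 + (norm (Q x))\<^sup>2"
  using norm_split[of "Z x"] by (simp add: P_Z Q_Z)

lemma inner_split: "x \<bullet> y = P x \<bullet> P y + Q x \<bullet> Q y"
proof -
  have "x \<bullet> y = (P x + Q x) \<bullet> (P y + Q y)" by (simp add: Q_def)
  then show ?thesis by (simp add: inner_add P_Q_orth Q_P_orth)
qed

text \<open>
  The inverse of \<open>L\<close> on the range of \<open>P\<close> is at least \<open>-1 / \<delta>\<close>, so adding \<open>\<alpha> > 1 / \<delta>\<close> makes it positive.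
\<close>

lemma S_coercive:
  assumes x: "x \<in> D" and \<alpha>: "\<alpha> > 1 / \<delta>"
  shows "min (\<alpha> - 1 / \<delta>) \<epsilon> * (norm (Z x))\<^sup>2 \<le> S \<alpha> \<epsilon> x \<bullet> Z x"
proof -
  have "S \<alpha> \<epsilon> x \<bullet> Z x = (\<alpha> * (norm (L (P x)))\<^sup>2 + L (P x) \<bullet> P x)
      + (L (Q x) \<bullet> Q x + \<epsilon> * (norm (Q x))\<^sup>2)"
    by (subst inner_split)
       (simp add: P_S Q_S P_Z Q_Z x inner_add inner_diff inner_commute power2_norm_eq_inner)
  moreover have "(\<alpha> - 1 / \<delta>) * (norm (L (P x)))\<^sup>2 \<le> \<alpha> * (norm (L (P x)))\<^sup>2 + L (P x) \<bullet> P x"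
    using L_P_form_ge[of x] by (simp add: algebra_simps)
  moreover have "\<epsilon> * (norm (Q x))\<^sup>2 \<le> L (Q x) \<bullet> Q x + \<epsilon> * (norm (Q x))\<^sup>2"
    using L_nonneg[OF Q_D[OF x]] by (simp add: PQ)
  moreover have "min (\<alpha> - 1 / \<delta>) \<epsilon> * (norm (L (P x)))\<^sup>2 \<le> (\<alpha> - 1 / \<delta>) * (norm (L (P x)))\<^sup>2"
    "min (\<alpha> - 1 / \<delta>) \<epsilon> * (norm (Q x))\<^sup>2 \<le> \<epsilon> * (norm (Q x))\<^sup>2"
    by (intro mult_right_mono; simp)+
  ultimately show ?thesis unfolding norm_Z by (simp add: distrib_left)
qed

text \<open>
  Both components reduce to resolvents of \<open>L\<close>: on the range of \<open>P\<close>, multiplying \<open>L\<^bsup>-1\<^esup> + \<alpha> + k\<close> by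
  \<open>L / (\<alpha> + k)\<close> gives \<open>L + 1 / (\<alpha> + k)\<close>, and \<open>\<alpha> > 1 / \<delta>\<close> puts \<open>-1 / (\<alpha> + k)\<close> into the gap \<open>(-\<delta>, 0)\<close>; on the range of \<open>Q\<close> the
  shift \<open>\<epsilon> + k\<close> exceeds the bound \<open>K\<close>.
\<close>

lemma S_shift_surj:
  assumes onto: "\<And>\<kappa> h. 0 < \<kappa> \<and> \<kappa> < \<delta> \<or> K < \<kappa> \<Longrightarrow> \<exists>u\<in>D. L u + \<kappa> *\<^sub>R u = h"
    and \<alpha>: "\<alpha> > 1 / \<delta>" and \<epsilon>: "\<epsilon> > 0" and k: "k > 0" "k > K"
  shows "\<exists>x\<in>D. S \<alpha> \<epsilon> x + k *\<^sub>R Z x = d"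
proof -
  have pos: "0 < 1 / \<delta>" using \<delta>_pos by simp
  have ak: "1 / \<delta> < \<alpha> + k" using \<alpha> k by simp
  have ak0: "0 < \<alpha> + k" using pos ak by linarith
  then have "0 < 1 / (\<alpha> + k)" "1 / (\<alpha> + k) < \<delta>"
    using ak \<delta>_pos by (auto simp: field_simps)
  then obtain a where a: "a \<in> D" "L a + (1 / (\<alpha> + k)) *\<^sub>R a = - (1 / (\<alpha> + k)) *\<^sub>R P d"
    using onto[of "1 / (\<alpha> + k)" "- (1 / (\<alpha> + k)) *\<^sub>R P d"] by auto
  obtain b where b: "b \<in> D" "L b + (\<epsilon> + k) *\<^sub>R b = d"
    using onto[of "\<epsilon> + k" d] \<epsilon> k by auto
  define x where "x = P a + Q b"
  have xD: "x \<in> D" unfolding x_def by (intro subspace_add[OF D] P_D Q_D b)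
  have Px: "P x = P a" and Qx: "Q x = Q b"
    by (simp_all add: x_def P_add P_idem PQ linear_add[OF Q_linear] QP QQ)
  have "L (P a) + (1 / (\<alpha> + k)) *\<^sub>R P a = - (1 / (\<alpha> + k)) *\<^sub>R P d"
    using arg_cong[OF a(2), of P] a(1) by (simp add: P_add P_scaleR L_P P_idem P_minus)
  then have "(\<alpha> + k) *\<^sub>R (L (P a) + (1 / (\<alpha> + k)) *\<^sub>R P a) = (\<alpha> + k) *\<^sub>R (- (1 / (\<alpha> + k)) *\<^sub>R P d)"
    by (rule arg_cong)
  then have 1: "(\<alpha> + k) *\<^sub>R L (P a) + P a = - P d"
    using ak0 by (simp add: scaleR_add_right)
  have 2: "L (Q b) + (\<epsilon> + k) *\<^sub>R Q b = Q d"
    using arg_cong[OF b(2), of Q] b(1) L_split[OF b(1)] P_L_Q[OF b(1)]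
    by (simp add: linear_add[OF Q_linear] linear_scale[OF Q_linear])
       (simp add: Q_def[of "L _"] P_L_P)
  have "S \<alpha> \<epsilon> x + k *\<^sub>R Z x = - ((\<alpha> + k) *\<^sub>R L (P a) + P a) + (L (Q b) + (\<epsilon> + k) *\<^sub>R Q b)"
    by (simp add: S_def Z_def Px Qx algebra_simps)
  also have "\<dots> = d" unfolding 1 2 by (simp add: Q_def)
  finally show ?thesis using xD by blast
qed

end

section \<open>Nonlinear equations with a reduced selfadjoint operator\<close>

context split_operator
begin

text \<open>
  Argument and value after the exchange of the components in the range of \<open>P\<close>, the value diminished by
  \<open>\<alpha> P\<close> of the new argument. With \<open>y = M u\<close> they parametrize the exchanged relation by \<open>u\<close>.
\<close>

definition swap_pos :: "'a \<Rightarrow> 'a \<Rightarrow> 'a" where "swap_pos u y = P y + Q u"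

definition swap_val :: "real \<Rightarrow> 'a \<Rightarrow> 'a \<Rightarrow> 'a" where "swap_val \<alpha> u y = P u + Q y - \<alpha> *\<^sub>R P y"

lemma P_swap: "P (swap_pos u y) = P y" "P (swap_val \<alpha> u y) = P u - \<alpha> *\<^sub>R P y"
  and Q_swap: "Q (swap_pos u y) = Q u" "Q (swap_val \<alpha> u y) = Q y"
  by (simp_all add: swap_pos_def swap_val_def P_add P_diff P_scaleR P_idem PQ linear_add[OF Q_linear]
      linear_diff[OF Q_linear] linear_scale[OF Q_linear] QP QQ)

text \<open>
  The exchange keeps the pairing, and subtracting \<open>\<alpha> P\<close> from the value costs exactly the term by which
  the nonlinearity is strongly monotone.
\<close>

lemma swap_inner:
  "(swap_val \<alpha> u y - swap_val \<alpha> a b) \<bullet> (swap_pos u y - swap_pos a b)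
    = (y - b) \<bullet> (u - a) - \<alpha> * (norm (P y - P b))\<^sup>2"
  by (subst (1 2) inner_split)
     (simp add: P_diff linear_diff[OF Q_linear] P_swap Q_swap power2_norm_eq_inner inner_diff
       inner_commute algebra_simps)

text \<open>
  Maximality is inherited from \<open>M\<close>: every pair arises from some argument \<open>u\<close> and value \<open>v\<close> by the exchange, and if the
  pair is related to the exchanged relation, then \<open>(u, v)\<close> is related to the graph of \<open>M\<close>.
\<close>

lemma swap_maximal_monotone:
  assumes mono: "\<And>u v. \<alpha> * (norm (P (M u) - P (M v)))\<^sup>2 \<le> (M u - M v) \<bullet> (u - v)"
    and hemi: "\<And>u v. (\<lambda>n. M (u + (1 / real (Suc n)) *\<^sub>R v) \<bullet> v) \<longlonglongrightarrow> M u \<bullet> v"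
    and \<alpha>: "0 \<le> \<alpha>"
  shows "maximal_monotone (range (\<lambda>u. (swap_pos u (M u), swap_val \<alpha> u (M u))))"
  unfolding maximal_monotone_def
proof (intro conjI allI impI)
  show "monotone_rel (range (\<lambda>u. (swap_pos u (M u), swap_val \<alpha> u (M u))))"
    using mono by (auto simp: monotone_rel_def swap_inner)
next
  fix x y
  assume *: "\<forall>(a, b)\<in>range (\<lambda>u. (swap_pos u (M u), swap_val \<alpha> u (M u))). 0 \<le> (y - b) \<bullet> (x - a)"
  define u where "u = P y + \<alpha> *\<^sub>R P x + Q x"
  define v where "v = P x + Q y"
  have x: "x = swap_pos u v" and y: "y = swap_val \<alpha> u v"
    by (simp_all add: u_def v_def swap_pos_def swap_val_def P_add P_scaleR P_idem PQ
        linear_add[OF Q_linear] linear_scale[OF Q_linear] QP QQ)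
       (simp_all add: Q_def)
  have "0 \<le> (v - M a) \<bullet> (u - a)" for a
  proof -
    have "0 \<le> (y - swap_val \<alpha> a (M a)) \<bullet> (x - swap_pos a (M a))" using * by blast
    also have "\<dots> = (v - M a) \<bullet> (u - a) - \<alpha> * (norm (P v - P (M a)))\<^sup>2"
      unfolding x y by (rule swap_inner)
    also have "\<dots> \<le> (v - M a) \<bullet> (u - a)" using \<alpha> by simp
    finally show ?thesis .
  qed
  then have "v = M u" by (rule hemicontinuous_monotone_maximal[OF hemi])
  then show "(x, y) \<in> range (\<lambda>u. (swap_pos u (M u), swap_val \<alpha> u (M u)))"
    using x y by blast
qed

lemma resolvent_nonexpansive:
  assumes mono: "0 \<le> (b - b') \<bullet> (a - a')" and k: "k > 0"
    and "k *\<^sub>R a + b = k *\<^sub>R q" "k *\<^sub>R a' + b' = k *\<^sub>R q'"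
  shows "norm (a - a') \<le> norm (q - q')"
proof -
  have b: "b - b' = k *\<^sub>R ((q - q') - (a - a'))"
  proof -
    have bb: "b = k *\<^sub>R q - k *\<^sub>R a" "b' = k *\<^sub>R q' - k *\<^sub>R a'"
      using assms(3,4) by (simp_all add: eq_diff_eq add.commute)
    show ?thesis unfolding bb by (simp add: algebra_simps)
  qed
  have "0 \<le> ((q - q') - (a - a')) \<bullet> (a - a')"
    using mono k unfolding b by (simp add: zero_le_mult_iff)
  then have "(norm (a - a'))\<^sup>2 \<le> (q - q') \<bullet> (a - a')"
    by (simp add: power2_norm_eq_inner inner_diff_left)
  also have "\<dots> \<le> norm (q - q') * norm (a - a')" by (rule norm_cauchy_schwarz)
  finally show ?thesis
    by (cases "a = a'") (auto simp: power2_eq_square)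
qed

text \<open>
  With \<open>J\<close> the resolvent of the exchanged relation, the equation reads
  \<open>S x + k (Z x - J (Z x)) = 0\<close>, so \<open>Z x\<close> is a fixed point of the map that sends \<open>q\<close> to \<open>Z x\<close> for the solution
  \<open>x\<close> of \<open>S x + k Z x = k J q\<close>. By coercivity \<open>Z x\<close> depends on \<open>J q\<close> with Lipschitz constant
  \<open>k / (m + k) < 1\<close>, and \<open>J\<close> is nonexpansive.
\<close>

lemma regularized_solution:
  assumes mono: "\<And>u v. \<alpha> * (norm (P (M u) - P (M v)))\<^sup>2 \<le> (M u - M v) \<bullet> (u - v)"
    and hemi: "\<And>u v. (\<lambda>n. M (u + (1 / real (Suc n)) *\<^sub>R v) \<bullet> v) \<longlonglongrightarrow> M u \<bullet> v"
    and onto: "\<And>\<kappa> h. 0 < \<kappa> \<and> \<kappa> < \<delta> \<or> K < \<kappa> \<Longrightarrow> \<exists>u\<in>D. L u + \<kappa> *\<^sub>R u = h"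
    and \<alpha>: "\<alpha> > 1 / \<delta>" and \<epsilon>: "\<epsilon> > 0" and k: "k > 0" "k > K"
  shows "\<exists>x\<in>D. \<exists>u. k *\<^sub>R (Z x - swap_pos u (M u)) = swap_val \<alpha> u (M u)
    \<and> S \<alpha> \<epsilon> x + swap_val \<alpha> u (M u) = 0"
proof -
  let ?p = "\<lambda>u. swap_pos u (M u)" and ?w = "\<lambda>u. swap_val \<alpha> u (M u)"
  have \<alpha>0: "0 \<le> \<alpha>" using \<alpha> \<delta>_pos divide_pos_pos[of 1 \<delta>] by linarith
  have "\<exists>u. k *\<^sub>R ?p u + ?w u = k *\<^sub>R q" for q
    using maximal_monotone_surj[OF swap_maximal_monotone[OF mono hemi \<alpha>0] k(1), of q] by auto
  then obtain J where J: "\<And>q. k *\<^sub>R ?p (J q) + ?w (J q) = k *\<^sub>R q" by metis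
  have J_nonexp: "norm (?p (J q) - ?p (J q')) \<le> norm (q - q')" for q q'
    by (rule resolvent_nonexpansive[OF _ k(1) J J]) (use mono in \<open>simp add: swap_inner\<close>)
  have "\<exists>x\<in>D. S \<alpha> \<epsilon> x + k *\<^sub>R Z x = k *\<^sub>R ?p (J q)" for q
    by (rule S_shift_surj[OF onto \<alpha> \<epsilon> k])
  then obtain X where XD: "\<And>q. X q \<in> D"
    and X: "\<And>q. S \<alpha> \<epsilon> (X q) + k *\<^sub>R Z (X q) = k *\<^sub>R ?p (J q)" by metis
  define m where "m = min (\<alpha> - 1 / \<delta>) \<epsilon>"
  have m: "m > 0" using \<alpha> \<epsilon> by (simp add: m_def)
  have "norm (Z (X q) - Z (X q')) \<le> k / (m + k) * norm (q - q')" for q q'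
  proof (cases "Z (X q) = Z (X q')")
    case False
    let ?x = "X q - X q'"
    have xD: "?x \<in> D" by (intro subspace_diff[OF D] XD)
    have eq: "S \<alpha> \<epsilon> ?x + k *\<^sub>R Z ?x = k *\<^sub>R (?p (J q) - ?p (J q'))"
      using X[of q] X[of q'] by (simp add: S_diff XD Z_diff algebra_simps)
    have "(m + k) * (norm (Z ?x))\<^sup>2 \<le> (S \<alpha> \<epsilon> ?x + k *\<^sub>R Z ?x) \<bullet> Z ?x"
      using S_coercive[OF xD \<alpha>, of \<epsilon>]
      by (simp add: m_def inner_add_left power2_norm_eq_inner distrib_right)
    also have "\<dots> \<le> norm (k *\<^sub>R (?p (J q) - ?p (J q'))) * norm (Z ?x)"
      unfolding eq by (rule norm_cauchy_schwarz)
    also have "\<dots> \<le> (k * norm (q - q')) * norm (Z ?x)"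
      using J_nonexp k by (intro mult_right_mono) auto
    finally have "(m + k) * norm (Z ?x) \<le> k * norm (q - q')"
      using False by (simp add: power2_eq_square Z_diff)
    then show ?thesis using m k by (simp add: Z_diff field_simps)
  qed (use m k in simp)
  then have "\<exists>!q. Z (X q) = q"
    using m k by (intro banach_fix_type[of "k / (m + k)"]) (auto simp: dist_norm)
  then obtain q where q: "Z (X q) = q" by blast
  have "?w (J q) = k *\<^sub>R (Z (X q) - ?p (J q))"
    using J[of q] unfolding q by (simp add: algebra_simps)
  moreover have "S \<alpha> \<epsilon> (X q) + k *\<^sub>R (Z (X q) - ?p (J q)) = 0"
    using X[of q] by (simp add: algebra_simps)
  ultimately show ?thesis using XD by (intro bexI[of _ "X q"] exI[of _ "J q"]) auto
qed

text \<open>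
  The bound must not depend on \<open>k\<close>. Coercivity and monotonicity, tested against the value of the exchanged relation
  at \<open>u = 0\<close>, bound \<open>Z x\<close>, hence the resolvent and \<open>u\<close>. For the \<open>Q\<close> component of the values
  no estimate is available before \<open>u\<close> is bounded: this is where \<open>M\<close> must map bounded sets to bounded sets.
\<close>

lemma regularized_bound:
  assumes mono: "\<And>u v. \<alpha> * (norm (P (M u) - P (M v)))\<^sup>2 \<le> (M u - M v) \<bullet> (u - v)"
    and bd: "\<And>B. bounded B \<Longrightarrow> bounded (M ` B)"
    and \<alpha>: "\<alpha> > 1 / \<delta>" and \<epsilon>: "\<epsilon> > 0"
  obtains B where "\<And>k x u. \<lbrakk>k \<ge> 1; x \<in> D; k *\<^sub>R (Z x - swap_pos u (M u)) = swap_val \<alpha> u (M u);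
      S \<alpha> \<epsilon> x + swap_val \<alpha> u (M u) = 0\<rbrakk> \<Longrightarrow> norm (swap_val \<alpha> u (M u)) \<le> B"
proof -
  define m where "m = min (\<alpha> - 1 / \<delta>) \<epsilon>"
  have m: "m > 0" using \<alpha> \<epsilon> by (simp add: m_def)
  have \<alpha>0: "0 \<le> \<alpha>" using \<alpha> \<delta>_pos divide_pos_pos[of 1 \<delta>] by linarith
  define z0 where "z0 = swap_pos 0 (M 0)"
  define w0 where "w0 = swap_val \<alpha> 0 (M 0)"
  define c where "c = \<alpha> + 1 / \<delta>"
  have c: "c \<ge> 0" using \<alpha>0 \<delta>_pos by (simp add: c_def)
  define B1 where "B1 = max 1 ((norm w0 + c * norm z0 + (norm w0)\<^sup>2 + norm w0 * norm z0) / m)"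
  define B2 where "B2 = B1 + 2 * norm z0 + norm w0"
  define B3 where "B3 = c * B1 + (\<alpha> + 1) * B2"
  obtain B4 where B4: "\<And>u. norm u \<le> B3 \<Longrightarrow> norm (M u) \<le> B4"
    using bd[OF bounded_cball[of 0 B3]] unfolding bounded_iff by force
  have "norm (swap_val \<alpha> u (M u)) \<le> B3 + B4 + \<alpha> * B4"
    if k: "k \<ge> 1" and xD: "x \<in> D" and zt: "k *\<^sub>R (Z x - swap_pos u (M u)) = swap_val \<alpha> u (M u)"
      and S0: "S \<alpha> \<epsilon> x + swap_val \<alpha> u (M u) = 0" for k x u
  proof -
    define z where "z = Z x"
    define p where "p = swap_pos u (M u)"
    define w where "w = swap_val \<alpha> u (M u)"
    have Sw: "S \<alpha> \<epsilon> x = - w" using S0 by (simp add: w_def eq_neg_iff_add_eq_0)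
    have w: "w = k *\<^sub>R (z - p)" using zt by (simp add: w_def p_def z_def)
    have wp: "0 \<le> (w - w0) \<bullet> (p - z0)"
      using mono[of u 0] unfolding w_def w0_def p_def z0_def swap_inner by simp
    have zn: "norm (L (P x)) \<le> norm z"
      unfolding z_def by (rule power2_le_imp_le) (simp_all add: norm_Z)
    have Px: "norm (P x) \<le> norm z / \<delta>"
      using norm_L_P_ge[of x] zn \<delta>_pos by (simp add: field_simps)
    have Pw: "norm (P w) \<le> c * norm z"
    proof -
      have "P w = \<alpha> *\<^sub>R L (P x) + P x"
        using arg_cong[OF P_S[OF xD, of \<alpha> \<epsilon>], of uminus] unfolding Sw P_minus by simp
      then have "norm (P w) \<le> \<alpha> * norm (L (P x)) + norm (P x)"
        using norm_triangle_ineq[of "\<alpha> *\<^sub>R L (P x)" "P x"] \<alpha>0 by simp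
      also have "\<dots> \<le> \<alpha> * norm z + norm z / \<delta>"
        using zn Px \<alpha>0 by (intro add_mono mult_left_mono)
      finally show ?thesis by (simp add: c_def distrib_right)
    qed
    \<comment> \<open>For \<open>norm z > 1\<close> all terms on the right of the energy estimate are at most linear in \<open>norm z\<close>.\<close>
    have z_bound: "norm z \<le> B1"
    proof (cases "norm z \<le> 1")
      case False
      then have "z \<noteq> 0" by auto
      \<comment> \<open>Only the \<open>P\<close> component of \<open>w\<close> matters here, because \<open>z0\<close> lies in the range of \<open>P\<close>.\<close>
      have wz0: "- (w \<bullet> z0) \<le> c * norm z * norm z0"
      proof -
        have "z0 = P z0" by (simp add: z0_def swap_pos_def P_add P_idem linear_0[OF Q_linear])
        then have "w \<bullet> z0 = P w \<bullet> z0" by (metis P_sym)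
        then have "- (w \<bullet> z0) \<le> norm (P w) * norm z0"
          using norm_cauchy_schwarz[of "- P w" z0] by simp
        also have "\<dots> \<le> c * norm z * norm z0" using Pw by (intro mult_right_mono) auto
        finally show ?thesis .
      qed
      have p_eq: "p = z - (1 / k) *\<^sub>R w" using k by (simp add: w)
      have "m * (norm z)\<^sup>2 \<le> - (w \<bullet> z)"
        using S_coercive[OF xD \<alpha>, of \<epsilon>] by (simp add: Sw m_def z_def)
      also have "\<dots> = - ((w - w0) \<bullet> (p - z0)) - w0 \<bullet> z + (w0 \<bullet> w - w \<bullet> w) / k - w \<bullet> z0 + w0 \<bullet> z0"
        by (simp add: p_eq inner_diff diff_divide_distrib)
      also have "\<dots> \<le> norm w0 * norm z + (norm w0)\<^sup>2 + c * norm z * norm z0 + norm w0 * norm z0"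
      proof -
        have "(w0 \<bullet> w - w \<bullet> w) \<le> (norm w0)\<^sup>2"
        proof -
          have "0 \<le> (w0 - w) \<bullet> (w0 - w)" "0 \<le> w \<bullet> w" "0 \<le> w0 \<bullet> w0" by simp_all
          then show ?thesis unfolding power2_norm_eq_inner
            by (simp add: inner_diff inner_commute del: inner_ge_zero)
        qed
        then have "(w0 \<bullet> w - w \<bullet> w) / k \<le> (norm w0)\<^sup>2"
          using k mult_left_mono[of 1 k "(norm w0)\<^sup>2"] by (simp add: pos_divide_le_eq)
        moreover have "- (w0 \<bullet> z) \<le> norm w0 * norm z"
          using norm_cauchy_schwarz[of "- w0" z] by simp
        moreover have "w0 \<bullet> z0 \<le> norm w0 * norm z0" by (rule norm_cauchy_schwarz)
        ultimately show ?thesis using wp wz0 by linarith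
      qed
      also have "\<dots> \<le> (norm w0 + c * norm z0 + (norm w0)\<^sup>2 + norm w0 * norm z0) * norm z"
      proof -
        have "(norm w0)\<^sup>2 + norm w0 * norm z0 \<le> ((norm w0)\<^sup>2 + norm w0 * norm z0) * norm z"
          using False mult_left_mono[of 1 "norm z" "(norm w0)\<^sup>2 + norm w0 * norm z0"] by simp
        then show ?thesis by (simp add: algebra_simps)
      qed
      finally have "m * norm z \<le> norm w0 + c * norm z0 + (norm w0)\<^sup>2 + norm w0 * norm z0"
        using \<open>z \<noteq> 0\<close> by (simp add: power2_eq_square mult.assoc[symmetric] mult_le_cancel_right)
      then have "norm z \<le> (norm w0 + c * norm z0 + (norm w0)\<^sup>2 + norm w0 * norm z0) / m"
        using m by (simp add: field_simps)
      then show ?thesis unfolding B1_def by linarith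
    qed (simp add: B1_def)
    \<comment> \<open>The resolvent maps \<open>z0 + w0 / k\<close> to \<open>z0\<close> and \<open>z\<close> to \<open>p\<close>.\<close>
    have "norm (p - z0) \<le> norm (z - (z0 + (1 / k) *\<^sub>R w0))"
      by (rule resolvent_nonexpansive[OF wp, of k]) (use k w in \<open>auto simp: algebra_simps\<close>)
    also have "\<dots> \<le> norm z + (norm z0 + norm w0)"
    proof -
      have "norm ((1 / k) *\<^sub>R w0) \<le> 1 * norm w0"
        unfolding norm_scaleR using k by (intro mult_right_mono) auto
      then show ?thesis
        using norm_triangle_ineq4[of z "z0 + (1 / k) *\<^sub>R w0"] norm_triangle_ineq[of z0 "(1 / k) *\<^sub>R w0"]
        by linarith
    qed
    finally have p_bound: "norm p \<le> B2"
      using norm_triangle_sub[of p z0] z_bound by (simp add: B2_def)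
    have "u = P w + \<alpha> *\<^sub>R P p + Q p"
      by (simp add: w_def p_def P_swap Q_swap) (simp add: Q_def)
    then have "norm u \<le> norm (P w) + norm (\<alpha> *\<^sub>R P p) + norm (Q p)"
      by (metis norm_add_leD norm_triangle_ineq add_right_mono order_trans)
    also have "\<dots> \<le> c * B1 + \<alpha> * B2 + B2"
      using Pw mult_left_mono[OF z_bound c] norm_P_le[of p] norm_Q_le[of p] p_bound \<alpha>0
      by (auto intro!: add_mono mult_left_mono)
    finally have u: "norm u \<le> B3" by (simp add: B3_def distrib_right)
    have "norm w \<le> norm (P u) + norm (Q (M u)) + \<alpha> * norm (P (M u))"
      unfolding w_def swap_val_def
      using norm_triangle_ineq4[of "P u + Q (M u)" "\<alpha> *\<^sub>R P (M u)"] norm_triangle_ineq[of "P u" "Q (M u)"] \<alpha>0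
      by simp
    also have "\<dots> \<le> B3 + B4 + \<alpha> * B4"
      using norm_P_le[of u] norm_Q_le[of "M u"] norm_P_le[of "M u"] u B4[OF u] \<alpha>0
      by (intro add_mono mult_left_mono) auto
    finally show ?thesis by (simp add: w_def)
  qed
  then show ?thesis using that by blast
qed

text \<open>
  The approximate solutions satisfy \<open>Z (x n) = p n + e n\<close> with the resolvent \<open>p n\<close> and an error \<open>e n = w n / k n\<close>. In the
  difference of two of the equations, the pairing of \<open>w i - w j\<close> with \<open>p i - p j\<close> has the good sign, so only the errors remain, and
  coercivity yields a Cauchy sequence. The points \<open>x n\<close> (in the domain of \<open>L\<close>) and \<open>u n\<close> (where \<open>M\<close> is evaluated)
  turn out to have the same limit.
\<close>

lemma solution_exists:
  assumes mono: "\<And>u v. \<alpha> * (norm (P (M u) - P (M v)))\<^sup>2 \<le> (M u - M v) \<bullet> (u - v)"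
    and demi: "\<And>u u0 v. u \<longlonglongrightarrow> u0 \<Longrightarrow> (\<lambda>n. M (u n) \<bullet> v) \<longlonglongrightarrow> M u0 \<bullet> v"
    and bd: "\<And>B. bounded B \<Longrightarrow> bounded (M ` B)"
    and onto: "\<And>\<kappa> h. 0 < \<kappa> \<and> \<kappa> < \<delta> \<or> K < \<kappa> \<Longrightarrow> \<exists>u\<in>D. L u + \<kappa> *\<^sub>R u = h"
    and \<alpha>: "\<alpha> > 1 / \<delta>" and \<epsilon>: "\<epsilon> > 0"
  shows "\<exists>x\<in>D. \<epsilon> *\<^sub>R Q x + L x + M x = 0"
proof -
  define m where "m = min (\<alpha> - 1 / \<delta>) \<epsilon>"
  have m: "m > 0" using \<alpha> \<epsilon> by (simp add: m_def)
  have hemi: "(\<lambda>n. M (u + (1 / real (Suc n)) *\<^sub>R v) \<bullet> v) \<longlonglongrightarrow> M u \<bullet> v" for u v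
  proof (rule demi)
    have "(\<lambda>n. u + (1 / real (Suc n)) *\<^sub>R v) \<longlonglongrightarrow> u + 0 *\<^sub>R v"
      by (intro tendsto_intros LIMSEQ_Suc lim_const_over_n)
    then show "(\<lambda>n. u + (1 / real (Suc n)) *\<^sub>R v) \<longlonglongrightarrow> u" by simp
  qed
  define k where "k n = real (Suc n) + \<bar>K\<bar>" for n
  have k: "1 \<le> k n" "0 < k n" "K < k n" "real (Suc n) \<le> k n" for n
    by (auto simp: k_def)
  have "\<exists>x\<in>D. \<exists>u. k n *\<^sub>R (Z x - swap_pos u (M u)) = swap_val \<alpha> u (M u)
      \<and> S \<alpha> \<epsilon> x + swap_val \<alpha> u (M u) = 0" for n
    by (rule regularized_solution[OF mono hemi onto \<alpha> \<epsilon> k(2,3)])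
  then obtain x u where xD: "\<And>n. x n \<in> D"
    and eq1: "\<And>n. k n *\<^sub>R (Z (x n) - swap_pos (u n) (M (u n))) = swap_val \<alpha> (u n) (M (u n))"
    and eq2: "\<And>n. S \<alpha> \<epsilon> (x n) + swap_val \<alpha> (u n) (M (u n)) = 0"
    by metis
  define w where "w n = swap_val \<alpha> (u n) (M (u n))" for n
  define p where "p n = swap_pos (u n) (M (u n))" for n
  define z where "z n = Z (x n)" for n
  obtain B where B: "\<And>n. norm (w n) \<le> B"
    unfolding w_def using regularized_bound[OF mono bd \<alpha> \<epsilon>] k(1) xD eq1 eq2 by metis
  have B0: "0 \<le> B" using B[of 0] norm_ge_zero[of "w 0"] by linarith
  have Sx: "S \<alpha> \<epsilon> (x n) = - w n" for n
    using eq2[of n] by (simp add: w_def eq_neg_iff_add_eq_0)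
  define e where "e n = (1 / k n) *\<^sub>R w n" for n
  have zp: "z n = p n + e n" for n
    unfolding e_def w_def eq1[of n, symmetric] using k(2)[of n] by (simp add: z_def p_def)
  have e_bound: "norm (e n) \<le> B * (1 / real (Suc n))" for n
  proof -
    have "norm (e n) = norm (w n) * (1 / k n)" using k(2)[of n] by (simp add: e_def)
    also have "\<dots> \<le> B * (1 / real (Suc n))"
      using B[of n] B0 k(2)[of n] k(4)[of n] by (intro mult_mono divide_left_mono) auto
    finally show ?thesis .
  qed
  have e_lim: "e \<longlonglongrightarrow> 0"
  proof (rule Lim_null_comparison)
    show "(\<lambda>n. B * (1 / real (Suc n))) \<longlonglongrightarrow> 0"
      using tendsto_mult[OF tendsto_const LIMSEQ_Suc[OF lim_const_over_n[of 1]], of B] by simp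
  qed (use e_bound in simp)
  have z_sq: "(norm (z i - z j))\<^sup>2 \<le> 2 * B\<^sup>2 / m * (1 / real (Suc i) + 1 / real (Suc j))" for i j
  proof -
    have "m * (norm (z i - z j))\<^sup>2 \<le> S \<alpha> \<epsilon> (x i - x j) \<bullet> Z (x i - x j)"
      using S_coercive[OF subspace_diff[OF D xD xD] \<alpha>, of \<epsilon> i j] by (simp add: m_def z_def Z_diff)
    also have "\<dots> = - ((w i - w j) \<bullet> (p i - p j)) - (w i - w j) \<bullet> (e i - e j)"
      by (simp add: S_diff xD Sx Z_diff z_def[symmetric] zp inner_diff inner_add)
    also have "\<dots> \<le> norm (w i - w j) * norm (e i - e j)"
    proof -
      have "0 \<le> (w i - w j) \<bullet> (p i - p j)"
        unfolding w_def p_def swap_inner using mono by simp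
      moreover have "- ((w i - w j) \<bullet> (e i - e j)) \<le> norm (w i - w j) * norm (e i - e j)"
        using norm_cauchy_schwarz[of "- (w i - w j)" "e i - e j"]
        unfolding norm_minus_cancel inner_minus_left .
      ultimately show ?thesis by linarith
    qed
    also have "\<dots> \<le> (2 * B) * (B * (1 / real (Suc i)) + B * (1 / real (Suc j)))"
    proof (rule mult_mono)
      show "norm (w i - w j) \<le> 2 * B"
        using norm_triangle_ineq4[of "w i" "w j"] B[of i] B[of j] by linarith
      show "norm (e i - e j) \<le> B * (1 / real (Suc i)) + B * (1 / real (Suc j))"
        using norm_triangle_ineq4[of "e i" "e j"] e_bound[of i] e_bound[of j] by linarith
    qed (use B0 in auto)
    also have "\<dots> = m * (2 * B\<^sup>2 / m * (1 / real (Suc i) + 1 / real (Suc j)))"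
    proof -
      have "(2 * B) * (B * s + B * t) = m * (2 * B\<^sup>2 / m * (s + t))" for s t
        using m by (simp add: power2_eq_square field_simps)
      then show ?thesis .
    qed
    finally show ?thesis using m mult_le_cancel_left_pos by blast
  qed
  obtain \<zeta> where z_lim: "z \<longlonglongrightarrow> \<zeta>"
    using Cauchy_of_square_bound[OF z_sq] Cauchy_convergent convergent_def by blast
  have "(norm (P (x i) - P (x j)))\<^sup>2 \<le> (2 * B\<^sup>2 / m / \<delta>\<^sup>2) * (1 / real (Suc i) + 1 / real (Suc j))" for i j
  proof -
    have "\<delta> * norm (P (x i - x j)) \<le> norm (L (P (x i - x j)))" by (rule norm_L_P_ge)
    also have "\<dots> \<le> norm (Z (x i - x j))"
      by (rule power2_le_imp_le) (simp_all add: norm_Z)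
    finally have "(\<delta> * norm (P (x i) - P (x j)))\<^sup>2 \<le> (norm (z i - z j))\<^sup>2"
      using \<delta>_pos by (intro power_mono) (simp_all add: P_diff Z_diff z_def)
    also note z_sq[of i j]
    finally have "\<delta>\<^sup>2 * (norm (P (x i) - P (x j)))\<^sup>2
        \<le> 2 * B\<^sup>2 / m * (1 / real (Suc i) + 1 / real (Suc j))"
      by (simp only: power_mult_distrib)
    then have "(norm (P (x i) - P (x j)))\<^sup>2
        \<le> 2 * B\<^sup>2 / m * (1 / real (Suc i) + 1 / real (Suc j)) / \<delta>\<^sup>2"
      using \<delta>_pos by (subst pos_le_divide_eq) (simp_all only: mult.commute zero_less_power)
    then show ?thesis by (simp only: times_divide_eq_left)
  qed
  then obtain \<xi> where Px_lim: "(\<lambda>n. P (x n)) \<longlonglongrightarrow> \<xi>"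
    using Cauchy_of_square_bound[of "\<lambda>n. P (x n)"] Cauchy_convergent convergent_def by blast
  note P_lim = bounded_linear.tendsto[OF bounded_linear_P]
    and Q_lim = bounded_linear.tendsto[OF bounded_linear_Q]
  have p_lim: "p \<longlonglongrightarrow> \<zeta>"
    using tendsto_diff[OF z_lim e_lim] by (simp add: zp)
  have x_eq: "x n = P (x n) + Q (z n)" for n
    by (simp add: z_def Q_Z) (simp add: Q_def)
  have x_lim: "x \<longlonglongrightarrow> \<xi> + Q \<zeta>"
    using tendsto_add[OF Px_lim Q_lim[OF z_lim]] by (simp only: x_eq[symmetric])
  have Pw: "P (w n) = P (x n) - \<alpha> *\<^sub>R P (z n)" for n
    using arg_cong[OF P_S[OF xD, of \<alpha> \<epsilon> n], of uminus]
    unfolding Sx P_minus by (simp add: z_def P_Z)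
  have u_eq: "u n = (P (x n) - \<alpha> *\<^sub>R P (z n)) + \<alpha> *\<^sub>R P (p n) + Q (p n)" for n
    unfolding Pw[symmetric] by (simp add: w_def p_def P_swap Q_swap) (simp add: Q_def)
  have "(\<lambda>n. (P (x n) - \<alpha> *\<^sub>R P (z n)) + \<alpha> *\<^sub>R P (p n) + Q (p n))
      \<longlonglongrightarrow> (\<xi> - \<alpha> *\<^sub>R P \<zeta>) + \<alpha> *\<^sub>R P \<zeta> + Q \<zeta>"
    by (intro tendsto_intros Px_lim P_lim Q_lim p_lim z_lim)
  then have u_lim: "u \<longlonglongrightarrow> \<xi> + Q \<zeta>" by (simp only: u_eq[symmetric] diff_add_cancel)
  define u0 where "u0 = \<xi> + Q \<zeta>"
  have Qx_lim: "(\<lambda>n. Q (x n)) \<longlonglongrightarrow> Q u0"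
    unfolding u0_def by (intro Q_lim x_lim)
  \<comment> \<open>The original equation, up to an error that tends to \<open>0\<close>.\<close>
  have Lx: "L (x n) = - M (u n) - P (e n) - \<epsilon> *\<^sub>R Q (x n)" for n
  proof -
    have lq: "L (Q (x n)) + \<epsilon> *\<^sub>R Q (x n) = - Q (M (u n))"
      using Q_S[OF xD, of \<alpha> \<epsilon> n] unfolding Sx
      by (simp add: linear_neg[OF Q_linear] w_def Q_swap)
    have lp: "L (P (x n)) = - P (M (u n)) - P (e n)"
    proof -
      have "L (P (x n)) = - P (z n)" by (simp add: z_def P_Z)
      also have "P (z n) = P (M (u n)) + P (e n)" by (simp add: zp P_add p_def P_swap)
      finally show ?thesis by simp
    qed
    have "L (x n) = L (P (x n)) + (L (Q (x n)) + \<epsilon> *\<^sub>R Q (x n)) - \<epsilon> *\<^sub>R Q (x n)"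
      using L_split[OF xD, of n] by simp
    also have "\<dots> = - M (u n) - P (e n) - \<epsilon> *\<^sub>R Q (x n)"
      unfolding lq lp Q_def[of "M (u n)"] by simp
    finally show ?thesis .
  qed
  \<comment> \<open>As \<open>M (u n)\<close>, and hence \<open>L (x n)\<close>, converges only weakly, \<open>L\<close> is moved to a test element of the domain.\<close>
  have "u0 \<in> D \<and> L u0 = - M u0 - \<epsilon> *\<^sub>R Q u0"
  proof (rule L_maximal)
    fix t assume t: "t \<in> D"
    have "(\<lambda>n. L t \<bullet> x n) \<longlonglongrightarrow> L t \<bullet> u0"
      unfolding u0_def by (intro tendsto_intros x_lim)
    moreover have "L t \<bullet> x n = - (M (u n) \<bullet> t) - P (e n) \<bullet> t - \<epsilon> * (Q (x n) \<bullet> t)" for n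
      unfolding L_sym[OF t xD] Lx by (simp add: inner_diff inner_commute)
    moreover have "(\<lambda>n. - (M (u n) \<bullet> t) - P (e n) \<bullet> t - \<epsilon> * (Q (x n) \<bullet> t))
        \<longlonglongrightarrow> - (M u0 \<bullet> t) - P 0 \<bullet> t - \<epsilon> * (Q u0 \<bullet> t)"
      by (intro tendsto_intros demi P_lim e_lim Qx_lim) (simp add: u0_def u_lim)
    ultimately have "L t \<bullet> u0 = - (M u0 \<bullet> t) - P 0 \<bullet> t - \<epsilon> * (Q u0 \<bullet> t)"
      using LIMSEQ_unique by simp
    then show "L t \<bullet> u0 = t \<bullet> (- M u0 - \<epsilon> *\<^sub>R Q u0)"
      by (simp add: P_0 inner_diff inner_commute)
  qed
  then show ?thesis by (intro bexI[of _ u0]) auto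
qed

text \<open>
  The two equations determine \<open>L (P (x - y))\<close> from the \<open>P\<close> components of the nonlinearity, so the
  strong monotonicity term is \<open>\<alpha> \<parallel>L (P (x - y))\<parallel>\<^sup>2\<close>, which exceeds the negative part of the form.
\<close>

lemma solution_unique:
  assumes mono: "\<And>u v. \<alpha> * (norm (P (M u) - P (M v)))\<^sup>2 \<le> (M u - M v) \<bullet> (u - v)"
    and \<alpha>: "\<alpha> > 1 / \<delta>" and \<epsilon>: "\<epsilon> > 0"
    and x: "x \<in> D" "\<epsilon> *\<^sub>R Q x + L x + M x = 0" and y: "y \<in> D" "\<epsilon> *\<^sub>R Q y + L y + M y = 0"
  shows "x = y"
proof -
  define w where "w = x - y"
  have wD: "w \<in> D" unfolding w_def by (intro subspace_diff[OF D] x y)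
  have "L w + \<epsilon> *\<^sub>R Q w + (M x - M y) = (\<epsilon> *\<^sub>R Q x + L x + M x) - (\<epsilon> *\<^sub>R Q y + L y + M y)"
    by (simp add: w_def L_diff x y linear_diff[OF Q_linear] algebra_simps)
  then have eq: "L w + \<epsilon> *\<^sub>R Q w = - (M x - M y)"
    unfolding x(2) y(2) eq_neg_iff_add_eq_0 diff_zero .
  have "L (P w) = - P (M x - M y)"
    using arg_cong[OF eq, of P] by (simp add: P_add P_diff P_scaleR PQ P_minus L_P wD)
  then have n: "norm (L (P w)) = norm (P (M x) - P (M y))"
    by (simp add: P_diff norm_minus_commute)
  have "\<alpha> * (norm (L (P w)))\<^sup>2 \<le> (M x - M y) \<bullet> w"
    unfolding n using mono[of x y] by (simp add: w_def)
  also have "\<dots> = - ((L w + \<epsilon> *\<^sub>R Q w) \<bullet> w)"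
    unfolding eq inner_minus_left minus_minus ..
  also have "\<dots> = - (L (P w) \<bullet> P w) - L (Q w) \<bullet> Q w - \<epsilon> * (norm (Q w))\<^sup>2"
    by (subst inner_split)
       (simp add: P_add P_scaleR PQ linear_add[OF Q_linear] linear_scale[OF Q_linear] QQ
         L_split[OF wD] P_L_P P_L_Q wD Q_def[of "L _"] inner_add power2_norm_eq_inner)
  also have "\<dots> \<le> (norm (L (P w)))\<^sup>2 / \<delta> - \<epsilon> * (norm (Q w))\<^sup>2"
    using L_P_form_ge[of w] L_nonneg[OF Q_D[OF wD]] by (simp add: PQ)
  finally have sum: "(\<alpha> - 1 / \<delta>) * (norm (L (P w)))\<^sup>2 + \<epsilon> * (norm (Q w))\<^sup>2 \<le> 0"
    by (simp add: algebra_simps)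
  moreover have "0 \<le> (\<alpha> - 1 / \<delta>) * (norm (L (P w)))\<^sup>2" "0 \<le> \<epsilon> * (norm (Q w))\<^sup>2"
    using \<alpha> \<epsilon> by auto
  ultimately have "(\<alpha> - 1 / \<delta>) * (norm (L (P w)))\<^sup>2 = 0" "\<epsilon> * (norm (Q w))\<^sup>2 = 0"
    by linarith+
  then have "L (P w) = 0" "Q w = 0" using \<alpha> \<epsilon> by auto
  moreover have "P w = 0"
    using norm_L_P_ge[of w] \<delta>_pos \<open>L (P w) = 0\<close> by (simp add: mult_le_0_iff)
  ultimately show ?thesis by (simp add: Q_def w_def)
qed

end

section \<open>Spectral families and gaps in the spectrum\<close>

locale spectral_resolution =
  fixes E :: "real \<Rightarrow> 'a::{real_inner,complete_space} \<Rightarrow> 'a"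
  assumes E_linear: "linear (E \<mu>)"
    and E_sym: "E \<mu> x \<bullet> y = x \<bullet> E \<mu> y"
    and E_E: "E \<mu> (E \<nu> x) = E (min \<mu> \<nu>) x"
    and E_right: "((\<lambda>\<nu>. E \<nu> u) \<longlongrightarrow> E \<mu> u) (at_right \<mu>)"
    and E_bot: "((\<lambda>\<mu>. E \<mu> u) \<longlongrightarrow> 0) at_bot"
    and E_top: "((\<lambda>\<mu>. E \<mu> u) \<longlongrightarrow> u) at_top"
begin

definition F :: "'a \<Rightarrow> real \<Rightarrow> real" where "F u \<mu> = E \<mu> u \<bullet> u"

definition \<nu> :: "'a \<Rightarrow> real measure" where "\<nu> u = interval_measure (F u)"

lemma E_add: "E \<mu> (x + y) = E \<mu> x + E \<mu> y" and E_diff: "E \<mu> (x - y) = E \<mu> x - E \<mu> y"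
  and E_scaleR: "E \<mu> (r *\<^sub>R x) = r *\<^sub>R E \<mu> x"
  using E_linear by (auto simp: linear_add linear_diff linear_scale)

lemma E_inner_E: "E a u \<bullet> E b u = F u (min a b)"
  by (metis E_E E_sym F_def inner_commute min.commute)

lemma F_mono: "a \<le> b \<Longrightarrow> F u a \<le> F u b"
  using inner_ge_zero[of "E b u - E a u"] by (simp add: inner_diff E_inner_E del: inner_ge_zero)

lemma F_right: "continuous (at_right a) (F u)"
  unfolding continuous_within F_def by (intro tendsto_intros E_right)

lemma F_bot: "(F u \<longlongrightarrow> 0) at_bot"
  using tendsto_inner[OF E_bot[of u] tendsto_const[of u]] unfolding F_def[abs_def] by simp

lemma F_top: "(F u \<longlongrightarrow> (norm u)\<^sup>2) at_top"
  using tendsto_inner[OF E_top[of u] tendsto_const[of u]]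
  unfolding F_def[abs_def] by (simp add: power2_norm_eq_inner)

lemma sets_\<nu> [simp, measurable_cong]: "sets (\<nu> u) = sets borel" and space_\<nu> [simp]: "space (\<nu> u) = UNIV"
  by (simp_all add: \<nu>_def)

lemma emeasure_\<nu>_UNIV: "emeasure (\<nu> u) UNIV = (norm u)\<^sup>2"
  unfolding \<nu>_def by (rule interval_measure_UNIV) (auto intro: F_mono F_right F_bot F_top)

lemma finite_measure_\<nu>: "finite_measure (\<nu> u)"
  by (rule finite_measureI) (simp add: emeasure_\<nu>_UNIV)

lemma measure_\<nu>_UNIV: "measure (\<nu> u) UNIV = (norm u)\<^sup>2"
  by (simp add: measure_def emeasure_\<nu>_UNIV)

lemma emeasure_\<nu>_Ioc: "a \<le> b \<Longrightarrow> emeasure (\<nu> u) {a<..b} = ennreal (F u b - F u a)"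
  unfolding \<nu>_def by (rule emeasure_interval_measure_Ioc) (auto intro: F_mono F_right)

lemma emeasure_\<nu>_Ioi: "emeasure (\<nu> u) {a<..} = ennreal ((norm u)\<^sup>2 - F u a)"
proof -
  interpret finite_measure "\<nu> u" by (rule finite_measure_\<nu>)
  have Iic: "measure (\<nu> u) {..a} = F u a"
    unfolding \<nu>_def by (rule measure_interval_measure_Iic) (auto intro: F_mono F_right F_bot F_top)
  have "{a<..} = UNIV - {..a}" by auto
  then have "measure (\<nu> u) {a<..} = measure (\<nu> u) UNIV - measure (\<nu> u) {..a}"
    using finite_measure_compl[of "{..a}"] by simp
  then show ?thesis by (simp add: emeasure_eq_measure measure_\<nu>_UNIV Iic)
qed

lemma norm_E: "(norm (E a u))\<^sup>2 = F u a"
  by (simp add: power2_norm_eq_inner E_inner_E)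

lemma F_E: "F (E a u) b = F u (min a b)"
  unfolding F_def[of "E a u"] by (simp add: E_E E_inner_E min.commute min.left_commute)

lemma F_compl: "F (u - E a u) b = F u b - F u (min a b)"
  unfolding F_def[of "u - E a u"]
  by (simp add: E_diff E_E inner_diff E_inner_E min.commute) (simp add: F_def)

lemma norm_compl: "(norm (u - E a u))\<^sup>2 = (norm u)\<^sup>2 - F u a"
  by (simp add: power2_norm_eq_inner inner_diff E_inner_E) (simp add: F_def inner_commute)

text \<open>
  Projecting with \<open>E a\<close> restricts the spectral measure to \<open>(-\<infinity>, a]\<close>, and projecting with \<open>I - E a\<close> restricts it to the
  complement. This makes forms and domains split along the spectrum.
\<close>

lemma \<nu>_E: "\<nu> (E a u) = density (\<nu> u) (indicator {..a})"
proof (rule measure_eqI_lessThan)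
  fix x
  have "emeasure (density (\<nu> u) (indicator {..a})) {x<..} = emeasure (\<nu> u) {x<..a}"
    by (subst emeasure_restricted) (auto intro!: arg_cong[where f = "emeasure (\<nu> u)"])
  also have "\<dots> = ennreal ((norm (E a u))\<^sup>2 - F (E a u) x)"
    by (cases "x \<le> a") (auto simp: emeasure_\<nu>_Ioc norm_E F_E min_def)
  finally show "emeasure (\<nu> (E a u)) {x<..} = emeasure (density (\<nu> u) (indicator {..a})) {x<..}"
    by (simp add: emeasure_\<nu>_Ioi)
qed (auto simp: emeasure_\<nu>_Ioi)

lemma \<nu>_compl: "\<nu> (u - E a u) = density (\<nu> u) (indicator {a<..})"
proof (rule measure_eqI_lessThan)
  fix x
  have "emeasure (density (\<nu> u) (indicator {a<..})) {x<..} = emeasure (\<nu> u) {max a x<..}"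
    by (subst emeasure_restricted) (auto intro!: arg_cong[where f = "emeasure (\<nu> u)"])
  also have "\<dots> = ennreal ((norm (u - E a u))\<^sup>2 - F (u - E a u) x)"
    by (auto simp: emeasure_\<nu>_Ioi norm_compl F_compl min_def max_def)
  finally show "emeasure (\<nu> (u - E a u)) {x<..} = emeasure (density (\<nu> u) (indicator {a<..})) {x<..}"
    by (simp add: emeasure_\<nu>_Ioi)
qed (auto simp: emeasure_\<nu>_Ioi)

lemma AE_\<nu>_E: "AE \<mu> in \<nu> (E a u). \<mu> \<le> a"
  unfolding \<nu>_E by (subst AE_density) (auto simp: indicator_def)

lemma AE_\<nu>_compl: "AE \<mu> in \<nu> (u - E a u). a < \<mu>"
  unfolding \<nu>_compl by (subst AE_density) (auto simp: indicator_def)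

lemma
  fixes f :: "real \<Rightarrow> real"
  assumes f: "integrable (\<nu> u) f"
  shows integrable_\<nu>_E: "integrable (\<nu> (E a u)) f"
    and integral_\<nu>_split:
      "integral\<^sup>L (\<nu> u) f = integral\<^sup>L (\<nu> (E a u)) f + integral\<^sup>L (\<nu> (u - E a u)) f"
proof -
  have fm [measurable]: "f \<in> borel_measurable borel"
    using borel_measurable_integrable[OF f] by simp
  have d: "density (\<nu> u) (indicator A) = density (\<nu> u) (\<lambda>x. ennreal (indicator A x))" for A
    by (intro arg_cong[where f = "density (\<nu> u)"]) (auto simp: indicator_def)
  have i: "integrable (\<nu> u) (\<lambda>x. indicator A x * f x)" if "A \<in> sets borel" for A
    using integrable_mult_indicator[of A "\<nu> u" f] f that by simp
  show "integrable (\<nu> (E a u)) f"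
    unfolding \<nu>_E d by (subst integrable_density; simp add: i)
  have "integral\<^sup>L (\<nu> u) f = (\<integral>x. indicator {..a} x * f x + indicator {a<..} x * f x \<partial>\<nu> u)"
    by (intro Bochner_Integration.integral_cong) (auto simp: indicator_def)
  also have "\<dots> = (\<integral>x. indicator {..a} x * f x \<partial>\<nu> u) + (\<integral>x. indicator {a<..} x * f x \<partial>\<nu> u)"
    by (intro Bochner_Integration.integral_add i) auto
  also have "\<dots> = integral\<^sup>L (\<nu> (E a u)) f + integral\<^sup>L (\<nu> (u - E a u)) f"
    unfolding \<nu>_E \<nu>_compl d by (subst (1 2) integral_density) auto
  finally show "integral\<^sup>L (\<nu> u) f = integral\<^sup>L (\<nu> (E a u)) f + integral\<^sup>L (\<nu> (u - E a u)) f" .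
qed

lemma integrable_id_of_square:
  assumes "integrable (\<nu> u) (\<lambda>\<mu>. \<mu>\<^sup>2)"
  shows "integrable (\<nu> u) (\<lambda>\<mu>. \<mu>)"
proof -
  interpret finite_measure "\<nu> u" by (rule finite_measure_\<nu>)
  have "integrable (\<nu> u) (\<lambda>\<mu>. 1 + \<mu>\<^sup>2)" using assms by simp
  then show ?thesis
  proof (rule Bochner_Integration.integrable_bound)
    have "\<bar>\<mu>\<bar> \<le> 1 + \<mu>\<^sup>2" for \<mu> :: real
      using zero_le_power2[of "\<bar>\<mu>\<bar> - 1"] by (simp add: power2_eq_square algebra_simps)
    then show "AE \<mu> in \<nu> u. norm \<mu> \<le> norm (1 + \<mu>\<^sup>2)" by simp
  qed simp
qed

lemma integral_id_bounds:
  assumes i: "integrable (\<nu> u) (\<lambda>\<mu>. \<mu>)"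
  shows integral_id_le: "AE \<mu> in \<nu> u. \<mu> \<le> b \<Longrightarrow> integral\<^sup>L (\<nu> u) (\<lambda>\<mu>. \<mu>) \<le> b * (norm u)\<^sup>2"
    and integral_id_ge: "AE \<mu> in \<nu> u. b \<le> \<mu> \<Longrightarrow> b * (norm u)\<^sup>2 \<le> integral\<^sup>L (\<nu> u) (\<lambda>\<mu>. \<mu>)"
proof -
  interpret finite_measure "\<nu> u" by (rule finite_measure_\<nu>)
  have c: "integral\<^sup>L (\<nu> u) (\<lambda>\<mu>. b) = b * (norm u)\<^sup>2" by (simp add: measure_\<nu>_UNIV)
  show "AE \<mu> in \<nu> u. \<mu> \<le> b \<Longrightarrow> integral\<^sup>L (\<nu> u) (\<lambda>\<mu>. \<mu>) \<le> b * (norm u)\<^sup>2"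
    unfolding c[symmetric] by (intro integral_mono_AE i) auto
  show "AE \<mu> in \<nu> u. b \<le> \<mu> \<Longrightarrow> b * (norm u)\<^sup>2 \<le> integral\<^sup>L (\<nu> u) (\<lambda>\<mu>. \<mu>)"
    unfolding c[symmetric] by (intro integral_mono_AE i) auto
qed

lemma square_integrable_band:
  assumes "E b u = u" "E a u = 0"
  shows "integrable (\<nu> u) (\<lambda>\<mu>. \<mu>\<^sup>2)"
proof -
  interpret finite_measure "\<nu> u" by (rule finite_measure_\<nu>)
  show ?thesis
  proof (rule integrable_const_bound[of _ "(max \<bar>a\<bar> \<bar>b\<bar>)\<^sup>2"])
    have sq: "\<mu>\<^sup>2 \<le> (max \<bar>a\<bar> \<bar>b\<bar>)\<^sup>2" if "a < \<mu>" "\<mu> \<le> b" for \<mu>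
      using that by (intro abs_le_square_iff[THEN iffD1]) auto
    have "AE \<mu> in \<nu> u. \<mu> \<le> b" using AE_\<nu>_E[of b u] unfolding assms .
    moreover have "AE \<mu> in \<nu> u. a < \<mu>" using AE_\<nu>_compl[of a u] unfolding assms diff_zero .
    ultimately show "AE \<mu> in \<nu> u. norm (\<mu>\<^sup>2) \<le> (max \<bar>a\<bar> \<bar>b\<bar>)\<^sup>2"
      by eventually_elim (use sq in simp)
  qed simp
qed

end

text \<open>
  The spectral integral prescribes the domain and, on it, the quadratic form of \<open>L\<close>; by polarization the
  form determines \<open>L\<close>.
\<close>

locale spectral_operator = spectral_resolution E + selfadjoint_real D L
  for E :: "real \<Rightarrow> 'a::{real_inner,complete_space} \<Rightarrow> 'a" and D :: "'a set" and L :: "'a \<Rightarrow> 'a" +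
  assumes D_eq: "D = {u. integrable (\<nu> u) (\<lambda>\<mu>. \<mu>\<^sup>2)}"
    and L_form: "u \<in> D \<Longrightarrow> L u \<bullet> u = integral\<^sup>L (\<nu> u) (\<lambda>\<mu>. \<mu>)"
begin

lemma E_D: "u \<in> D \<Longrightarrow> E a u \<in> D"
  by (simp add: D_eq integrable_\<nu>_E)

lemma form_split:
  assumes "u \<in> D"
  shows "L u \<bullet> u = L (E a u) \<bullet> E a u + L (u - E a u) \<bullet> (u - E a u)"
  using assms integral_\<nu>_split[OF integrable_id_of_square, of u a]
  by (simp add: L_form E_D subspace_diff[OF D]) (simp add: D_eq)

lemma polarization:
  assumes "u \<in> D" "v \<in> D"
  shows "4 * (L u \<bullet> v) = L (u + v) \<bullet> (u + v) - L (u - v) \<bullet> (u - v)"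
  using L_sym[OF assms] by (simp add: L_add L_diff assms inner_add inner_diff inner_commute)

text \<open>
  The form of \<open>L\<close> splits along \<open>E a\<close> and \<open>I - E a\<close>, so by polarization \<open>4 \<langle>L (E a u), v\<rangle>\<close> depends on \<open>u\<close> and \<open>v\<close> only
  through \<open>E a u\<close> and \<open>E a v\<close>, symmetrically. Hence \<open>\<langle>L v, E a u\<rangle> = \<langle>v, E a (L u)\<rangle>\<close>, and selfadjointness
  shows that \<open>E a u\<close> is in the domain with the right image.
\<close>

lemma L_E:
  assumes u: "u \<in> D"
  shows "L (E a u) = E a (L u)"
proof -
  have *: "4 * (L (E a u) \<bullet> v) = L (E a u + E a v) \<bullet> (E a u + E a v) - L (E a u - E a v) \<bullet> (E a u - E a v)"
    if "u \<in> D" "v \<in> D" for u v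
  proof -
    have s: "E a u + v - E a (E a u + v) = v - E a v" "E a u - v - E a (E a u - v) = - (v - E a v)"
      by (simp_all add: E_add E_diff E_E)
    have sq: "L (E a v - v) \<bullet> (E a v - v) = L (v - E a v) \<bullet> (v - E a v)"
      using that by (simp add: L_diff E_D inner_diff)
    show ?thesis
      using polarization[OF E_D[OF that(1)] that(2), of a] that
      by (simp add: form_split[of "E a u + v" a] form_split[of "E a u - v" a] E_D
          subspace_add[OF D] subspace_diff[OF D] s sq)
         (simp add: E_add E_diff E_E)
  qed
  have "L v \<bullet> E a u = v \<bullet> E a (L u)" if v: "v \<in> D" for v
  proof -
    have "L v \<bullet> E a u = L (E a u) \<bullet> v"
      using L_sym[OF E_D[OF u] v] by (simp add: inner_commute)
    also have "\<dots> = L (E a v) \<bullet> u"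
    proof -
      have "L (E a v - E a u) \<bullet> (E a v - E a u) = L (E a u - E a v) \<bullet> (E a u - E a v)"
        using u v by (simp add: L_diff E_D inner_diff)
      then show ?thesis using *[OF u v] *[OF v u] by (simp add: add.commute)
    qed
    also have "\<dots> = v \<bullet> E a (L u)"
      using L_sym[OF E_D[OF v] u] by (simp add: E_sym)
    finally show ?thesis .
  qed
  then show ?thesis using L_maximal[of "E a u" "E a (L u)"] by blast
qed

lemma form_le:
  assumes "u \<in> D" "E b u = u"
  shows "L u \<bullet> u \<le> b * (norm u)\<^sup>2"
proof -
  have "integrable (\<nu> u) (\<lambda>\<mu>. \<mu>)"
    using assms(1) by (intro integrable_id_of_square) (simp add: D_eq)
  moreover have "AE \<mu> in \<nu> u. \<mu> \<le> b" using AE_\<nu>_E[of b u] unfolding assms .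
  ultimately show ?thesis unfolding L_form[OF assms(1)] by (rule integral_id_le)
qed

lemma form_ge:
  assumes "u \<in> D" "E a u = 0"
  shows "a * (norm u)\<^sup>2 \<le> L u \<bullet> u"
proof -
  have "integrable (\<nu> u) (\<lambda>\<mu>. \<mu>)"
    using assms(1) by (intro integrable_id_of_square) (simp add: D_eq)
  moreover have "AE \<mu> in \<nu> u. a \<le> \<mu>"
    using AE_\<nu>_compl[of a u] unfolding assms diff_zero by (rule eventually_mono) simp
  ultimately show ?thesis unfolding L_form[OF assms(1)] by (rule integral_id_ge)
qed

text \<open>
  The spectral integral represents the form of \<open>L\<close>, so it bounds the numerical radius of \<open>L - c\<close> on the invariant band \<open>V\<close> by \<open>\<eta>\<close>, and for a symmetric operator the numerical radius is the norm.
\<close>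

lemma band_norm_le:
  assumes w: "E b w = w" "E a w = 0" and ab: "a \<le> b" "c - \<eta> \<le> a" "b \<le> c + \<eta>"
  shows "norm (L w - c *\<^sub>R w) \<le> \<eta> * norm w"
proof (cases "L w - c *\<^sub>R w = 0")
  case True
  then show ?thesis using ab by simp
next
  case False
  define V where "V = {v. E b v = v \<and> E a v = 0}"
  have wV: "w \<in> V"
    using w by (simp add: V_def)
  have VD: "v \<in> D" if "v \<in> V" for v
    using that square_integrable_band[of b v a] by (simp add: V_def D_eq)
  define T where "T v = L v - c *\<^sub>R v" for v
  have TV: "T v \<in> V" if "v \<in> V" for v
  proof -
    have "E b (L v) = L v" "E a (L v) = L 0"
      using that L_E[OF VD[OF that], of b] L_E[OF VD[OF that], of a] by (simp_all add: V_def)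
    moreover have "L 0 = 0" using L_scaleR[OF VD[OF that], of 0] by simp
    ultimately show ?thesis using that by (simp add: V_def T_def E_diff E_scaleR)
  qed
  have V: "subspace V"
    using E_linear by (auto simp: V_def subspace_def linear_0 E_add E_scaleR)
  have form: "\<bar>T v \<bullet> v\<bar> \<le> \<eta> * (norm v)\<^sup>2" if v: "v \<in> V" for v
  proof -
    have "L v \<bullet> v \<le> b * (norm v)\<^sup>2" "a * (norm v)\<^sup>2 \<le> L v \<bullet> v"
      using form_le[OF VD[OF v], of b] form_ge[OF VD[OF v], of a] v by (auto simp: V_def)
    moreover have "b * (norm v)\<^sup>2 \<le> (c + \<eta>) * (norm v)\<^sup>2" "(c - \<eta>) * (norm v)\<^sup>2 \<le> a * (norm v)\<^sup>2"
      using ab by (auto intro!: mult_right_mono)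
    ultimately show ?thesis
      by (simp add: T_def inner_diff_left power2_norm_eq_inner algebra_simps abs_le_iff)
  qed
  have bilinear: "4 * (T v \<bullet> v') \<le> 2 * \<eta> * ((norm v)\<^sup>2 + (norm v')\<^sup>2)" if v: "v \<in> V" "v' \<in> V" for v v'
  proof -
    have "4 * (T v \<bullet> v') = T (v + v') \<bullet> (v + v') - T (v - v') \<bullet> (v - v')"
      using polarization[OF VD[OF v(1)] VD[OF v(2)]]
      by (simp add: T_def inner_add inner_diff inner_commute algebra_simps)
    also have "\<dots> \<le> \<eta> * (norm (v + v'))\<^sup>2 + \<eta> * (norm (v - v'))\<^sup>2"
      using form[OF subspace_add[OF V v]] form[OF subspace_diff[OF V v]] by linarith
    also have "\<dots> = 2 * \<eta> * ((norm v)\<^sup>2 + (norm v')\<^sup>2)"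
      by (simp add: power2_norm_eq_inner inner_add inner_diff inner_commute algebra_simps)
    finally show ?thesis .
  qed
  \<comment> \<open>This \<open>t\<close> gives \<open>t T w\<close> the norm of \<open>w\<close>, which is optimal in the polarized inequality.\<close>
  define t where "t = norm w / norm (T w)"
  have Tw: "norm (T w) > 0" using False by (simp add: T_def)
  have "4 * (T w \<bullet> (t *\<^sub>R T w)) \<le> 2 * \<eta> * ((norm w)\<^sup>2 + (norm (t *\<^sub>R T w))\<^sup>2)"
    by (intro bilinear wV subspace_scale[OF V] TV)
  moreover have "T w \<bullet> (t *\<^sub>R T w) = norm w * norm (T w)"
    using Tw by (simp add: t_def power2_norm_eq_inner[symmetric] power2_eq_square)
  moreover have "norm (t *\<^sub>R T w) = norm w"
    using Tw by (simp add: t_def)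
  ultimately have "norm w * norm (T w) \<le> \<eta> * (norm w)\<^sup>2" by simp
  moreover have "w \<noteq> 0" using Tw TV[OF wV] L_scaleR[OF VD[OF wV], of 0] by (auto simp: T_def)
  ultimately show ?thesis by (simp add: T_def power2_eq_square)
qed

text \<open>
  If \<open>L - c\<close> is bounded below by \<open>1 / C\<close>, a spectral band around \<open>c\<close> on which \<open>\<parallel>L - c\<parallel> \<le> \<eta>\<close> with \<open>C \<eta> < 1\<close> is trivial.
\<close>

lemma E_locally_constant:
  assumes C: "\<And>u. u \<in> D \<Longrightarrow> norm u \<le> C * norm (L u - c *\<^sub>R u)"
  shows "\<exists>\<eta>>0. \<forall>x. \<bar>x - c\<bar> < \<eta> \<longrightarrow> E x u = E c u"
proof -
  define \<eta> where "\<eta> = 1 / (2 * (\<bar>C\<bar> + 1))"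
  have \<eta>: "\<eta> > 0" by (simp add: \<eta>_def)
  have C\<eta>: "\<bar>C\<bar> * \<eta> \<le> 1 / 2" by (simp add: \<eta>_def field_simps)
  have const: "E b u = E a u" if ab: "a \<le> b" "c - \<eta> \<le> a" "b \<le> c + \<eta>" for a b
  proof -
    define w where "w = E b u - E a u"
    have band: "E b w = w" "E a w = 0"
      using ab(1) by (simp_all add: w_def E_diff E_E min_def)
    then have "w \<in> D" using square_integrable_band by (simp add: D_eq)
    then have "norm w \<le> C * norm (L w - c *\<^sub>R w)" by (rule C)
    also have "\<dots> \<le> \<bar>C\<bar> * norm (L w - c *\<^sub>R w)" by (intro mult_right_mono) auto
    also have "\<dots> \<le> \<bar>C\<bar> * (\<eta> * norm w)"
      using band_norm_le[OF band ab] by (intro mult_left_mono) auto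
    also have "\<dots> \<le> 1 / 2 * norm w"
      unfolding mult.assoc[symmetric] by (intro mult_right_mono C\<eta>) auto
    finally show ?thesis by (simp add: w_def)
  qed
  have "E x u = E c u" if "\<bar>x - c\<bar> < \<eta>" for x
    using const[of x c] const[of c x] that \<eta> by (cases "x \<le> c") auto
  then show ?thesis using \<eta> by blast
qed

lemma E_constant_on_gap:
  assumes gap: "convex I" "open I"
    and C: "\<And>c. c \<in> I \<Longrightarrow> \<exists>C. \<forall>u\<in>D. norm u \<le> C * norm (L u - c *\<^sub>R u)"
    and xy: "x \<in> I" "y \<in> I"
  shows "E x u = E y u"
proof -
  have "\<exists>k. \<forall>x\<in>I. E x u = k"
  proof (rule has_derivative_zero_constant[OF gap(1)])
    fix c assume c: "c \<in> I"
    obtain C' where "\<And>u. u \<in> D \<Longrightarrow> norm u \<le> C' * norm (L u - c *\<^sub>R u)" using C[OF c] by blast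
    then obtain \<eta> where \<eta>: "\<eta> > 0" "\<And>x. \<bar>x - c\<bar> < \<eta> \<Longrightarrow> E x u = E c u"
      using E_locally_constant[of C' c u] by blast
    have "((\<lambda>x. E c u) has_derivative (\<lambda>h. 0)) (at c within I)" by simp
    then show "((\<lambda>x. E x u) has_derivative (\<lambda>h. 0)) (at c within I)"
      by (rule has_derivative_transform_within[OF _ \<eta>(1) c]) (metis \<eta>(2) dist_real_def)
  qed
  then show ?thesis using xy by metis
qed

end

section \<open>Complex selfadjoint operators and the projections of a spectral family\<close>

lemma linear_of_complex_linear:
  fixes f :: "'a::complex_inner \<Rightarrow> 'a"
  assumes "Vector_Spaces.linear scaleC scaleC f"
  shows "linear f"
proof -
  interpret f: Vector_Spaces.linear scaleC scaleC f by (rule assms)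
  show ?thesis by (rule linearI) (simp_all add: f.add f.scale scaleR_scaleC)
qed

lemma cinner_diff_left: "cinner (x - y) z = cinner x z - cinner y (z :: 'a::complex_inner)"
  using cinner_add_left[of "x - y" y z] by simp

lemma cinner_zero_left: "cinner 0 (x :: 'a::complex_inner) = 0"
  using cinner_diff_left[of x x x] by simp

lemma proj_onto_eqI:
  fixes S :: "'a::complex_inner set"
  assumes S: "\<And>v w. \<lbrakk>v \<in> S; w \<in> S\<rbrakk> \<Longrightarrow> v - w \<in> S"
    and p: "p \<in> S" "\<And>v. v \<in> S \<Longrightarrow> cinner (u - p) v = 0"
  shows "proj_onto S u = p"
  unfolding proj_onto_def
proof (rule the_equality)
  fix q assume q: "q \<in> S \<and> (\<forall>v\<in>S. cinner (u - q) v = 0)"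
  then have v: "p - q \<in> S" using S p by blast
  have "cinner (p - q) (p - q) = cinner (u - q) (p - q) - cinner (u - p) (p - q)"
    by (simp add: cinner_diff_left[symmetric])
  also have "\<dots> = 0" using p q v by simp
  finally have "inner (p - q) (p - q) = 0" by (simp add: inner_eq_Re_cinner)
  then show "q = p" by simp
qed (use p in blast)

lemma proj_onto_range_and_kernel:
  fixes P :: "'a::complex_inner \<Rightarrow> 'a"
  assumes P: "orthogonal_projection P"
  shows "proj_onto (range P) = P" "proj_onto {u. P u = 0} = (\<lambda>u. u - P u)"
proof -
  have lin: "linear P" and idem: "\<And>x. P (P x) = P x" and sym: "\<And>x y. cinner (P x) y = cinner x (P y)"
    using P by (auto simp: orthogonal_projection_def intro: linear_of_complex_linear)
  show "proj_onto (range P) = P"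
  proof
    fix u
    show "proj_onto (range P) u = P u"
    proof (rule proj_onto_eqI)
      show "v - w \<in> range P" if "v \<in> range P" "w \<in> range P" for v w
        using that by (auto simp: linear_diff[OF lin, symmetric])
      show "cinner (u - P u) v = 0" if "v \<in> range P" for v
        using that by (auto simp: sym[symmetric] linear_diff[OF lin] idem cinner_zero_left)
    qed simp
  qed
  show "proj_onto {u. P u = 0} = (\<lambda>u. u - P u)"
  proof
    fix u
    show "proj_onto {u. P u = 0} u = u - P u"
    proof (rule proj_onto_eqI)
      show "cinner (u - (u - P u)) v = 0" if "v \<in> {u. P u = 0}" for v
        using that sym[of u v] cinner_commute[of u 0] by (simp add: cinner_zero_left)
    qed (auto simp: linear_diff[OF lin] idem)
  qed
qed

text \<open>
  Real parts suffice: replacing \<open>u\<close> by \<open>\<i> u\<close> recovers the imaginary part of \<open>\<langle>L u, v\<rangle>\<close>.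
  Density of the domain makes the adjoint single-valued.
\<close>

lemma selfadjoint_symmetric_maximal:
  fixes D :: "'a::complex_inner set"
  assumes sa: "selfadjoint D L"
  shows selfadjoint_symmetric: "\<lbrakk>u \<in> D; v \<in> D\<rbrakk> \<Longrightarrow> L u \<bullet> v = u \<bullet> L v"
    and selfadjoint_maximal: "(\<And>u. u \<in> D \<Longrightarrow> L u \<bullet> v = u \<bullet> w) \<Longrightarrow> v \<in> D \<and> L v = w"
proof -
  have lin: "linear_operator D L" and dense: "closure D = UNIV" and dom: "adjoint_dom D L = D"
    and op: "\<And>v. v \<in> D \<Longrightarrow> adjoint_op D L v = L v"
    using sa by (auto simp: selfadjoint_def)
  have adj: "v \<in> D \<and> L v = w" if vw: "\<forall>u\<in>D. cinner (L u) v = cinner u w" for v w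
  proof -
    have v: "v \<in> D" using vw dom by (auto simp: adjoint_dom_def)
    have "adjoint_op D L v = w"
      unfolding adjoint_op_def
    proof (rule the_equality)
      fix w' assume w': "\<forall>u\<in>D. cinner (L u) v = cinner u w'"
      have "D \<subseteq> {u. u \<bullet> (w' - w) = 0}"
        using vw w' unfolding inner_diff_right by (auto simp: inner_eq_Re_cinner)
      moreover have "closed {u. u \<bullet> (w' - w) = 0}"
        by (intro closed_Collect_eq continuous_intros)
      ultimately have "closure D \<subseteq> {u. u \<bullet> (w' - w) = 0}" by (rule closure_minimal)
      then have "(w' - w) \<bullet> (w' - w) = 0" using dense by blast
      then show "w' = w" by simp
    qed (use vw in blast)
    then show ?thesis using op[OF v] v by simp
  qed
  show "L u \<bullet> v = u \<bullet> L v" if uv: "u \<in> D" "v \<in> D"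
  proof -
    obtain w where w: "\<forall>u\<in>D. cinner (L u) v = cinner u w"
      using uv(2) dom by (auto simp: adjoint_dom_def)
    then have "L v = w" using adj by blast
    then show ?thesis using w uv by (simp add: inner_eq_Re_cinner)
  qed
  show "v \<in> D \<and> L v = w" if re: "\<And>u. u \<in> D \<Longrightarrow> L u \<bullet> v = u \<bullet> w"
  proof (intro adj ballI complex_eqI)
    fix u assume u: "u \<in> D"
    show "Re (cinner (L u) v) = Re (cinner u w)"
      using re[OF u] by (simp add: inner_eq_Re_cinner)
    have iu: "\<i> *\<^sub>C u \<in> D" and Liu: "L (\<i> *\<^sub>C u) = \<i> *\<^sub>C L u"
      using lin u by (auto simp: linear_operator_def complex_vector.subspace_scale)
    show "Im (cinner (L u) v) = Im (cinner u w)"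
      using re[OF iu] by (simp add: Liu inner_eq_Re_cinner cinner_scaleC_left)
  qed
qed

lemma spectral_operator_of_spectral_family:
  fixes D :: "'a::complex_hilbert_space set"
  assumes sa: "selfadjoint D L" and sf: "spectral_family D L E"
  shows "spectral_operator E D L"
proof -
  have roi: "resolution_of_identity E" using sf by (simp add: spectral_family_def)
  have op: "orthogonal_projection (E \<mu>)" for \<mu> using roi by (simp add: resolution_of_identity_def)
  have lin: "linear_operator D L" using sa by (simp add: selfadjoint_def)
  have res: "spectral_resolution E"
  proof (rule spectral_resolution.intro)
    show "linear (E \<mu>)" for \<mu>
      using op by (auto simp: orthogonal_projection_def intro: linear_of_complex_linear)
    show "E \<mu> x \<bullet> y = x \<bullet> E \<mu> y" for \<mu> x y
      using op by (simp add: orthogonal_projection_def inner_eq_Re_cinner)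
    show "E \<mu> (E \<nu> x) = E (min \<mu> \<nu>) x" for \<mu> \<nu> x
      using roi by (cases "\<mu> \<le> \<nu>") (auto simp: resolution_of_identity_def min_def)
  qed (use roi in \<open>auto simp: resolution_of_identity_def\<close>)
  interpret spectral_resolution E by (rule res)
  have \<nu>: "spectral_measure E = \<nu>"
    by (simp add: fun_eq_iff spectral_measure_def \<nu>_def F_def[abs_def] inner_eq_Re_cinner)
  show ?thesis
  proof (intro spectral_operator.intro res spectral_operator_axioms.intro)
    show "selfadjoint_real D L"
    proof (rule selfadjoint_real.intro)
      show "subspace D"
        unfolding subspace_def scaleR_scaleC
        using lin by (auto simp: linear_operator_def complex_vector.subspace_def)
      show "L (u + v) = L u + L v" if "u \<in> D" "v \<in> D" for u v
        using lin that by (auto simp: linear_operator_def)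
      show "L (r *\<^sub>R u) = r *\<^sub>R L u" if "u \<in> D" for r u
        using lin that by (auto simp: linear_operator_def scaleR_scaleC)
      show "L u \<bullet> v = u \<bullet> L v" if "u \<in> D" "v \<in> D" for u v
        using selfadjoint_symmetric[OF sa that] .
      show "v \<in> D \<and> L v = w" if "\<And>u. u \<in> D \<Longrightarrow> L u \<bullet> v = u \<bullet> w" for v w
        using selfadjoint_maximal[OF sa that] .
    qed
    show "D = {u. integrable (\<nu> u) (\<lambda>\<mu>. \<mu>\<^sup>2)}"
      using sf by (simp add: spectral_family_def \<nu>)
    show "L u \<bullet> u = integral\<^sup>L (\<nu> u) (\<lambda>\<mu>. \<mu>)" if "u \<in> D" for u
      using sf that by (simp add: spectral_family_def \<nu> inner_eq_Re_cinner)
  qed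
qed

lemma real_resolvent_point:
  fixes D :: "'a::complex_inner set" and c :: real
  assumes "complex_of_real c \<in> resolvent_set D L"
  shows "\<exists>C. \<forall>u\<in>D. norm u \<le> C * norm (L u - c *\<^sub>R u)" "\<exists>u\<in>D. L u - c *\<^sub>R u = h"
proof -
  show "\<exists>C. \<forall>u\<in>D. norm u \<le> C * norm (L u - c *\<^sub>R u)"
    using assms by (simp add: resolvent_set_def scaleR_scaleC)
  have "(\<lambda>u. L u - c *\<^sub>R u) ` D = UNIV"
    using assms by (simp add: resolvent_set_def scaleR_scaleC bij_betw_def)
  then have "h \<in> (\<lambda>u. L u - c *\<^sub>R u) ` D" by simp
  then show "\<exists>u\<in>D. L u - c *\<^sub>R u = h" by blast
qed

section \<open>Solvability of the nonlinear equation\<close>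

theorem theorem3p2:
  fixes D :: "'a::complex_hilbert_space set" and L N :: "'a \<Rightarrow> 'a"
    and E :: "real \<Rightarrow> 'a \<Rightarrow> 'a" and \<delta> \<gamma> \<alpha> :: real
  defines "P1 \<equiv> proj_onto (H1 E \<delta>)" and "P2 \<equiv> proj_onto (H2 E)"
  assumes "separable_space (euclidean :: 'a topology)"
    and "selfadjoint D L"
    and "spectral_family D L E"
    and "0 \<in> spectrum D L"
    and "\<delta> > 0" and "complex_of_real ` {-\<delta><..<0} \<subseteq> resolvent_set D L"
    and "\<gamma> \<ge> 0"
    and "bdd_below {\<mu>. complex_of_real \<mu> \<in> spectrum D L}"
    and "Inf {\<mu>. complex_of_real \<mu> \<in> spectrum D L} = -\<gamma>"
    and "bounded_map N" and "demicontinuous N" and "N 0 = 0"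
    and "\<alpha> > \<gamma> / \<delta>\<^sup>2"
    and "\<And>u u'. Re (cinner (N u - N u') (u - u')) \<ge> \<alpha> * (norm (P1 (N u) - P1 (N u')))\<^sup>2"
  shows "\<forall>\<epsilon>>0. \<forall>h. \<exists>!u. u \<in> D \<and> \<epsilon> *\<^sub>R P2 u + L u + N u = h"
proof -
  note sa = \<open>selfadjoint D L\<close> and sf = \<open>spectral_family D L E\<close> and \<delta> = \<open>\<delta> > 0\<close>
  interpret spec: spectral_operator E D L
    by (rule spectral_operator_of_spectral_family[OF sa sf])
  have op: "orthogonal_projection (E \<mu>)" for \<mu>
    using sf by (simp add: spectral_family_def resolution_of_identity_def)
  have gap: "complex_of_real c \<in> resolvent_set D L" if "- \<delta> < c" "c < 0" for c
    using \<open>complex_of_real ` {-\<delta><..<0} \<subseteq> resolvent_set D L\<close> that by auto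
  have below: "complex_of_real c \<in> resolvent_set D L" if "c < - \<gamma>" for c
  proof (rule ccontr)
    assume "complex_of_real c \<notin> resolvent_set D L"
    then have "Inf {\<mu>. complex_of_real \<mu> \<in> spectrum D L} \<le> c"
      by (intro cInf_lower assms(10)) (simp add: spectrum_def)
    then show False using assms(11) that by simp
  qed
  have bounded_below: "\<exists>C. \<forall>u\<in>D. norm u \<le> C * norm (L u - c *\<^sub>R u)"
    if "complex_of_real c \<in> resolvent_set D L" for c
    by (rule real_resolvent_point(1)[OF that])
  have E_low: "E a u = 0" if a: "a < - \<gamma>" for a u
  proof -
    have "E b u = E a u" if "b \<in> {..< - \<gamma>}" for b
      by (rule spec.E_constant_on_gap[of "{..< - \<gamma>}"])
         (use a that below bounded_below in auto)
    then have "\<forall>\<^sub>F b in at_bot. E b u = E a u"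
      using eventually_gt_at_bot by (auto simp: eventually_at_bot_dense intro: exI[of _ "- \<gamma>"])
    then have "((\<lambda>b. E b u) \<longlongrightarrow> E a u) at_bot" by (rule tendsto_eventually)
    then show ?thesis using tendsto_unique[OF _ _ spec.E_bot] trivial_limit_at_bot_linorder by blast
  qed
  have E_gap: "E c u = E (- \<delta>) u" if c: "- \<delta> \<le> c" "c < 0" for c u
  proof (cases "c = - \<delta>")
    case False
    have "E b u = E c u" if "b \<in> {- \<delta><..<0}" for b
      by (rule spec.E_constant_on_gap[of "{- \<delta><..<0}"])
         (use c False that gap bounded_below in auto)
    then have "\<forall>\<^sub>F b in at_right (- \<delta>). E b u = E c u"
      using \<delta> by (intro eventually_at_rightI[of _ 0]) auto
    then have "((\<lambda>b. E b u) \<longlongrightarrow> E c u) (at_right (- \<delta>))" by (rule tendsto_eventually)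
    then show ?thesis
      using tendsto_unique[OF _ _ spec.E_right] trivial_limit_at_right_real by blast
  qed simp
  define P where "P = E (- \<delta>)"
  \<comment> \<open>The range of \<open>P\<close> is a bounded spectral band, because \<open>E\<close> vanishes below \<open>-\<gamma>\<close>.\<close>
  have P_D: "P x \<in> D" for x
  proof -
    have "E (- \<gamma> - 1) (P x) = 0" by (rule E_low) simp
    moreover have "E (- \<delta>) (P x) = P x" by (simp add: P_def spec.E_E)
    ultimately show ?thesis using spec.square_integrable_band by (simp add: spec.D_eq)
  qed
  interpret split_operator D L P \<delta>
  proof (intro split_operator.intro split_operator_axioms.intro spec.selfadjoint_real_axioms)
    show "L (P u) \<bullet> P u \<le> - \<delta> * (norm (P u))\<^sup>2" for u
      by (rule spec.form_le[OF P_D]) (simp add: P_def spec.E_E)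
    show "0 \<le> L u \<bullet> u" if u: "u \<in> D" "P u = 0" for u
    proof -
      have "c * (norm u)\<^sup>2 \<le> L u \<bullet> u" if "- \<delta> < c" "c < 0" for c
        using that u E_gap[of c u] by (intro spec.form_ge) (auto simp: P_def)
      then have "\<forall>\<^sub>F c in at_left 0. c * (norm u)\<^sup>2 \<le> L u \<bullet> u"
        using \<delta> by (intro eventually_at_leftI[of "- \<delta>"]) auto
      moreover have "((\<lambda>c. c * (norm u)\<^sup>2) \<longlongrightarrow> 0 * (norm u)\<^sup>2) (at_left 0)"
        by (intro tendsto_intros)
      ultimately have "0 * (norm u)\<^sup>2 \<le> L u \<bullet> u"
        by (intro tendsto_upperbound) auto
      then show ?thesis by simp
    qed
    show "P x \<bullet> y = x \<bullet> P y" for x y unfolding P_def by (rule spec.E_sym)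
    show "L (P u) = P (L u)" if "u \<in> D" for u unfolding P_def using that by (rule spec.L_E)
    show "P (P x) = P x" for x by (simp add: P_def spec.E_E)
    show "linear P" unfolding P_def by (rule spec.E_linear)
  qed (fact P_D \<delta>)+
  have P1: "P1 = P"
    unfolding P1_def H1_def P_def by (rule proj_onto_range_and_kernel(1)[OF op])
  have P2: "P2 = Q"
  proof -
    have "left_limit_0 E u = P u" for u
    proof -
      have "\<forall>\<^sub>F k in sequentially. 1 / real (Suc k) < \<delta>"
        using order_tendstoD(2)[OF LIMSEQ_Suc[OF lim_const_over_n[of "1::real"]] \<delta>] .
      then have "\<forall>\<^sub>F k in sequentially. E (- 1 / real (Suc k)) u = P u"
        by eventually_elim (use E_gap in \<open>auto simp: P_def\<close>)
      then show ?thesis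
        unfolding left_limit_0_def by (intro limI tendsto_eventually)
    qed
    then have H2: "H2 E = {u. P u = 0}" by (simp add: H2_def)
    have "P2 u = u - P u" for u
      unfolding P2_def H2 unfolding P_def proj_onto_range_and_kernel(2)[OF op] ..
    then show ?thesis by (simp add: fun_eq_iff Q_def)
  qed
  \<comment> \<open>If \<open>\<gamma> < \<delta>\<close>, then \<open>-\<delta>\<close> lies below the spectrum, \<open>P = 0\<close>, and any constant serves in place of \<open>\<alpha>\<close>.\<close>
  have "\<exists>\<beta>>1 / \<delta>. \<forall>u v. \<beta> * (norm (P (N u) - P (N v)))\<^sup>2 \<le> (N u - N v) \<bullet> (u - v)"
  proof (cases "\<gamma> < \<delta>")
    case True
    have "P x = 0" for x using E_low[of "- \<delta>" x] True by (simp add: P_def)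
    then show ?thesis
      using assms(16) by (intro exI[of _ "1 / \<delta> + 1"]) (simp add: P1 inner_eq_Re_cinner)
  next
    case False
    have "1 / \<delta> = \<delta> / \<delta>\<^sup>2" using \<delta> by (simp add: power2_eq_square)
    also have "\<dots> \<le> \<gamma> / \<delta>\<^sup>2" using False by (intro divide_right_mono) auto
    finally show ?thesis
      using assms(15,16) by (intro exI[of _ \<alpha>]) (simp add: P1 inner_eq_Re_cinner)
  qed
  then obtain \<beta> where \<beta>: "\<beta> > 1 / \<delta>"
    and N_mono: "\<And>u v. \<beta> * (norm (P (N u) - P (N v)))\<^sup>2 \<le> (N u - N v) \<bullet> (u - v)" by blast
  show ?thesis
  proof (intro allI impI)
    fix \<epsilon> :: real and h :: 'a
    assume \<epsilon>: "\<epsilon> > 0"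
    define M where "M u = N u - h" for u
    have mono: "\<beta> * (norm (P (M u) - P (M v)))\<^sup>2 \<le> (M u - M v) \<bullet> (u - v)" for u v
      using N_mono[of u v] by (simp add: M_def P_diff)
    have demi: "(\<lambda>n. M (u n) \<bullet> v) \<longlonglongrightarrow> M u0 \<bullet> v" if "u \<longlonglongrightarrow> u0" for u u0 v
    proof -
      have "(\<lambda>n. cinner (N (u n)) v) \<longlonglongrightarrow> cinner (N u0) v"
        using \<open>demicontinuous N\<close> that by (auto simp: demicontinuous_def)
      then have "(\<lambda>n. N (u n) \<bullet> v) \<longlonglongrightarrow> N u0 \<bullet> v"
        unfolding inner_eq_Re_cinner by (rule tendsto_Re)
      then show ?thesis unfolding M_def inner_diff_left by (rule tendsto_diff[OF _ tendsto_const])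
    qed
    have bd: "bounded (M ` B)" if "bounded B" for B
    proof -
      have "M ` B = (\<lambda>x. - h + x) ` (N ` B)" by (simp add: M_def image_image)
      moreover have "bounded (N ` B)" using \<open>bounded_map N\<close> that by (simp add: bounded_map_def)
      ultimately show ?thesis by (metis bounded_translation)
    qed
    have onto: "\<exists>u\<in>D. L u + \<kappa> *\<^sub>R u = d" if "0 < \<kappa> \<and> \<kappa> < \<delta> \<or> \<gamma> < \<kappa>" for \<kappa> d
    proof -
      have "complex_of_real (- \<kappa>) \<in> resolvent_set D L"
        using gap[of "- \<kappa>"] below[of "- \<kappa>"] that by auto
      from real_resolvent_point(2)[OF this, of d] show ?thesis by simp
    qed
    have eq: "\<epsilon> *\<^sub>R P2 u + L u + N u = h \<longleftrightarrow> \<epsilon> *\<^sub>R Q u + L u + M u = 0" for u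
      by (simp add: P2 M_def algebra_simps)
    obtain x where x: "x \<in> D" "\<epsilon> *\<^sub>R Q x + L x + M x = 0"
      using solution_exists[OF mono demi bd onto \<beta> \<epsilon>] by blast
    show "\<exists>!u. u \<in> D \<and> \<epsilon> *\<^sub>R P2 u + L u + N u = h"
      unfolding eq
    proof (rule ex1I[of _ x])
      fix y assume "y \<in> D \<and> \<epsilon> *\<^sub>R Q y + L y + M y = 0"
      then show "y = x" using solution_unique[OF mono \<beta> \<epsilon> _ _ x] by blast
    qed (use x in blast)
  qed
qed

end
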